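(* Let $(G,p)$ be an $r$-dimensional bar framework on $n$ vertices in $\mathbb{R}^r$, $r\le n-2$, with configuration matrix $P$ satisfying $P^Te=\mathbf{0}$. Then $(G,p)$ is dimensionally rigid if and only if there exist nonzero quasi-stress matrices $\Omega^0,\Omega^1,\ldots,\Omega^k$ of $(G,p)$, for some $k\le n-r-1$, such that: 1. $\Omega^0\succeq\mathbf{0}$, $\mathcal{U}_1^T\Omega^1\mathcal{U}_1\succeq\mathbf{0}$, $\ldots$, $\mathcal{U}_k^T\Omega^k\mathcal{U}_k\succeq\mathbf{0}$; 2. $\mathrm{rank}\,\Omega^0+\mathrm{rank}(\mathcal{U}_1^T\Omega^1\mathcal{U}_1)+\cdots+\mathrm{rank}(\mathcal{U}_k^T\Omega^k\mathcal{U}_k)=n-r-1$; 3. $P^T\Omega^1\rho_1=\mathbf{0}$, $\ldots$, $P^T\Omega^k\rho_k=\mathbf{0}$; where $\rho_1,\ldots,\rho_k$, $\mathcal{U}_1,\ldots,\mathcal{U}_k$ and $\xi_1,\ldots,\xi_k$ are full column rank matrices defined as follows: $\mathscr{R}(\rho_1)=\mathscr{N}\left(\begin{bmatrix}\Omega^0\\ P^T\\ e^T\end{bmatrix}\right)$; $\mathscr{R}(\xi_i)=\mathscr{N}(\rho_i^T\Omega^i\rho_i)$ and $\mathcal{U}_i=[P\;\;\rho_i]$ for $i=1,\ldots,k$; and $\rho_{i+1}=\rho_i\xi_i$ for $i=1,\ldots,k-1$.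
   Context: A bar framework $(G,p)$ in $\mathbb{R}^r$ is a simple connected undirected graph $G$ on nodes $1,\ldots,n$ together with points $p^1,\ldots,p^n\in\mathbb{R}^r$ (the nodes); $E(G)$ is the edge set of $G$ and $E(\overline{G})=\{\{i,j\}:i\ne j,\{i,j\}\notin E(G)\}$. It is $r$-dimensional if $p^1,\ldots,p^n$ affinely span $\mathbb{R}^r$. An $s$-dimensional framework $(G,p')$ in $\mathbb{R}^s$ is equivalent to $(G,p)$ if $\|p'^i-p'^j\|^2=\|p^i-p^j\|^2$ for each $\{i,j\}\in E(G)$. An $r$-dimensional framework $(G,p)$ is dimensionally rigid if no $s$-dimensional framework $(G,p')$, for any $s\ge r+1$, is equivalent to $(G,p)$. The configuration matrix $P$ of $(G,p)$ is the $n\times r$ matrix whose $i$th row is $(p^i)^T$. $e\in\mathbb{R}^n$ is the all-ones vector. A quasi-stress matrix of $(G,p)$ is an $n\times n$ real symmetric matrix $\Omega$ such that (a) $P^T\Omega P=\mathbf{0}$, (b) $\Omega_{ij}=0$ for all $\{i,j\}\in E(\overline{G})$, and (c) $\Omega e=\mathbf{0}$. $A\succeq\mathbf{0}$ means $A$ is symmetric positive semidefinite; $\mathscr{R}(A)$ and $\mathscr{N}(A)$ denote the column space and null space of $A$. Matrices with zero columns are allowed when the relevant null space is trivial. *)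

theory Defs
  imports "Jordan_Normal_Form.DL_Rank" "Jordan_Normal_Form.Matrix_Kernel" "Graph_Theory.Graph_Theory"
begin

section \<open>Matrices\<close>

text \<open>
  The locale \<open>vec_space\<close> defines rank and column space relative to an explicit ambient
  dimension; it is always the number of rows here. A matrix without columns has rank 0,
  column space \<open>{0}\<close>, and full column rank.
\<close>

abbreviation mat_rank :: "real mat \<Rightarrow> nat" where
  "mat_rank A \<equiv> vec_space.rank (dim_row A) A"

abbreviation column_space :: "real mat \<Rightarrow> real vec set" where
  "column_space A \<equiv> vec_space.col_space (dim_row A) A"

definition full_column_rank :: "real mat \<Rightarrow> bool" where
  "full_column_rank A \<longleftrightarrow> mat_rank A = dim_col A"

definition psd :: "real mat \<Rightarrow> bool" where
  "psd A \<longleftrightarrow> square_mat A \<and> A\<^sup>T = A \<and> (\<forall>x \<in> carrier_vec (dim_row A). x \<bullet> (A *\<^sub>v x) \<ge> 0)"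

definition hcat :: "'a mat \<Rightarrow> 'a mat \<Rightarrow> 'a mat" where
  "hcat A B = mat_of_cols (dim_row A) (cols A @ cols B)"

abbreviation ones_vec :: "nat \<Rightarrow> real vec" where
  "ones_vec n \<equiv> vec n (\<lambda>_. 1)"

section \<open>Bar frameworks\<close>

text \<open>
  The nodes \<open>1, \<dots>, n\<close> are numbered \<open>0, \<dots>, n - 1\<close>. A finite simple undirected graph is a
  loop-free symmetric digraph: the edge \<open>{i, j}\<close> is the pair of arcs \<open>(i, j)\<close> and \<open>(j, i)\<close>.
\<close>

definition bar_framework :: "nat \<Rightarrow> nat \<Rightarrow> nat pair_pre_digraph \<Rightarrow> (nat \<Rightarrow> real vec) \<Rightarrow> bool" where
  "bar_framework n r G p \<longleftrightarrow>
     pair_graph G \<and> pverts G = {0..<n} \<and> Digraph_Component.connected (with_proj G) \<and>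
     (\<forall>i<n. p i \<in> carrier_vec r)"

definition affine_span :: "nat \<Rightarrow> nat \<Rightarrow> (nat \<Rightarrow> real vec) \<Rightarrow> real vec set" where
  "affine_span n r p =
     {vec r (\<lambda>j. \<Sum>i<n. c i * p i $ j) | c :: nat \<Rightarrow> real. (\<Sum>i<n. c i) = 1}"

text \<open>An \<open>r\<close>-dimensional bar framework on \<open>n\<close> nodes, with ambient space \<open>\<real>\<^sup>r\<close>.\<close>

definition dim_framework :: "nat \<Rightarrow> nat \<Rightarrow> nat pair_pre_digraph \<Rightarrow> (nat \<Rightarrow> real vec) \<Rightarrow> bool" where
  "dim_framework n r G p \<longleftrightarrow> bar_framework n r G p \<and> affine_span n r p = carrier_vec r"

definition sq_dist :: "real vec \<Rightarrow> real vec \<Rightarrow> real" where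
  "sq_dist x y = (x - y) \<bullet> (x - y)"

text \<open>The two configurations \<open>p\<close> and \<open>q\<close> may live in spaces of different dimensions.\<close>

definition equivalent_configurations ::
    "nat pair_pre_digraph \<Rightarrow> (nat \<Rightarrow> real vec) \<Rightarrow> (nat \<Rightarrow> real vec) \<Rightarrow> bool" where
  "equivalent_configurations G p q \<longleftrightarrow>
     (\<forall>(i, j) \<in> parcs G. sq_dist (q i) (q j) = sq_dist (p i) (p j))"

definition dimensionally_rigid ::
    "nat \<Rightarrow> nat \<Rightarrow> nat pair_pre_digraph \<Rightarrow> (nat \<Rightarrow> real vec) \<Rightarrow> bool" where
  "dimensionally_rigid n r G p \<longleftrightarrow>
     dim_framework n r G p \<and>
     \<not> (\<exists>s q. s \<ge> r + 1 \<and> dim_framework n s G q \<and> equivalent_configurations G p q)"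

definition configuration_matrix :: "nat \<Rightarrow> nat \<Rightarrow> (nat \<Rightarrow> real vec) \<Rightarrow> real mat" where
  "configuration_matrix n r p = mat_of_rows r (map p [0..<n])"

definition quasi_stress_matrix ::
    "nat \<Rightarrow> nat \<Rightarrow> nat pair_pre_digraph \<Rightarrow> (nat \<Rightarrow> real vec) \<Rightarrow> real mat \<Rightarrow> bool" where
  "quasi_stress_matrix n r G p \<Omega> \<longleftrightarrow>
     \<Omega> \<in> carrier_mat n n \<and> \<Omega>\<^sup>T = \<Omega> \<and>
     (configuration_matrix n r p)\<^sup>T * \<Omega> * configuration_matrix n r p = 0\<^sub>m r r \<and>
     (\<forall>i<n. \<forall>j<n. i \<noteq> j \<and> (i, j) \<notin> parcs G \<longrightarrow> \<Omega> $$ (i, j) = 0) \<and>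
     \<Omega> *\<^sub>v ones_vec n = 0\<^sub>v n"

end

(*
  Every configuration q equivalent to p has zero energy for each quasi-stress W: the sum of x . W x
  over its coordinate vectors x vanishes.  A positive semidefinite stress therefore confines the x to
  its kernel, which contains the space T spanned by the columns of P and e; the later stresses, which
  only have to be positive semidefinite on the part not yet excluded, shrink that space further.  The
  rank condition says that at the end only T is left, so q has affine dimension at most r.

  Conversely (facial reduction), let the columns of U = [P rho] be independent and orthogonal to e.  If
  some positive definite Y made U Y U^T satisfy the edge length equations, a Cholesky factor of Y would
  turn the rows of U into an equivalent framework of dimension r + dim rho.  By rigidity the convex set
  of length defects of all U Y U^T avoids 0 when rho has columns.  A properly separating functional, read
  as edge weights, is a stress W with U^T W U positive semidefinite and nonzero; since it vanishes on
  P P^T, the blocks P^T W P and P^T W rho are zero.  Replacing rho by a basis of the kernel of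
  rho^T W rho lowers its dimension, so the process ends.
*)
theory Submission
  imports Defs
begin

section \<open>Separation and positive definite forms\<close>

text \<open>The set of length defects is convex but need not be closed, and a functional vanishing
  on all of it would be useless. Hence a separation that asks for no topology and yields a point of
  strict positivity. On the defects the functional depends only on the trace pairing of
  \<open>U\<^sup>T * W * U\<close> with \<open>Y\<close>, and strictness there is what makes
  \<open>\<rho>\<^sup>T * W * \<rho>\<close> nonzero.

  The given configuration corresponds to Y = diag(I, 0), on the boundary of the cone of positive
  definite matrices. Boundedness below on the open cone makes \<open>U\<^sup>T * W * U\<close>
  semidefinite and the trace of its P-block at most 0; so this block has zero diagonal, and
  semidefiniteness clears its rows.

  \<open>\<Omega> 0\<close> differs from the other stresses: it is semidefinite on the whole space,
  and \<open>\<rho> 1\<close> depends on it. The same reduction supplies both. Run from a basis of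
  the orthogonal complement of T, its first stress is semidefinite everywhere; run again from the
  part of that stress's kernel orthogonal to T, it gives the chain. Ranks add up because the rank at
  each stage is exactly the number of columns that \<open>\<rho>\<close> loses.\<close>

text \<open>Induction on the coordinates. If coordinate \<open>e\<close> takes both signs on
  \<open>C\<close>, the weights found for the slice \<open>x e = 0\<close> are extended by one
  weight for \<open>e\<close>, as in the proof of the Hahn-Banach theorem.\<close>

lemma proper_separation:
  fixes C :: "('e \<Rightarrow> real) set"
  assumes "finite E" and "C \<noteq> {}"
    and "\<And>x y t. x \<in> C \<Longrightarrow> y \<in> C \<Longrightarrow> 0 < t \<Longrightarrow> t < 1 \<Longrightarrow> (\<lambda>e. (1 - t) * x e + t * y e) \<in> C"
    and "\<not> (\<exists>x\<in>C. \<forall>e\<in>E. x e = 0)"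
  shows "\<exists>w. (\<forall>x\<in>C. 0 \<le> (\<Sum>e\<in>E. w e * x e)) \<and> (\<exists>x\<in>C. 0 < (\<Sum>e\<in>E. w e * x e))"
  using assms
proof (induction E arbitrary: C rule: finite_induct)
  case empty
  thus ?case by auto
next
  case (insert e E)
  note conv = insert.prems(2)
  have single: "(\<Sum>f\<in>insert e E. (if f = e then s else 0) * x f) = s * x e" for s and x :: "'e \<Rightarrow> real"
  proof -
    have "(\<Sum>f\<in>E. (if f = e then s else 0) * x f) = 0"
      using insert.hyps by (intro sum.neutral) auto
    thus ?thesis using insert.hyps by simp
  qed
  have ext: "(\<Sum>f\<in>insert e E. (w(e := t)) f * x f) = t * x e + (\<Sum>f\<in>E. w f * x f)" for w t and x :: "'e \<Rightarrow> real"
  proof -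
    have "(\<Sum>f\<in>E. (w(e := t)) f * x f) = (\<Sum>f\<in>E. w f * x f)"
      using insert.hyps by (intro sum.cong) auto
    thus ?thesis using insert.hyps by simp
  qed
  \<comment> \<open>\<open>t\<close> is the parameter at which the segment from \<open>x\<close> to
    \<open>y\<close> crosses the hyperplane where coordinate \<open>e\<close> vanishes.\<close>
  have mix: "\<exists>t. 0 < t \<and> t < 1 \<and> t * (y e - x e) = - x e \<and> (1 - t) * x e + t * y e = 0"
    if "x e < 0" "0 < y e" for x y :: "'e \<Rightarrow> real"
    using that by (intro exI[of _ "- x e / (y e - x e)"]) (auto simp: field_simps)
  define C0 where "C0 = {x\<in>C. x e = 0}"
  consider (pos) "\<forall>x\<in>C. 0 \<le> x e" "\<exists>x\<in>C. 0 < x e"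
    | (neg) "\<forall>x\<in>C. x e \<le> 0" "\<exists>x\<in>C. x e < 0"
    | (zero) "\<forall>x\<in>C. x e = 0"
    | (both) "\<exists>x\<in>C. x e < 0" "\<exists>x\<in>C. 0 < x e"
    by (metis linorder_not_less nle_le)
  thus ?case
  proof cases
    case pos
    thus ?thesis using single[of 1] by (intro exI[of _ "\<lambda>f. if f = e then 1 else 0"]) auto
  next
    case neg
    thus ?thesis using single[of "-1"] by (intro exI[of _ "\<lambda>f. if f = e then -1 else 0"]) auto
  next
    case zero
    have "\<not> (\<exists>x\<in>C. \<forall>e\<in>E. x e = 0)" using zero insert.prems(3) by auto
    from insert.IH[OF insert.prems(1) conv this] obtain w where
      w: "\<forall>x\<in>C. 0 \<le> (\<Sum>e\<in>E. w e * x e)" "\<exists>x\<in>C. 0 < (\<Sum>e\<in>E. w e * x e)" by blast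
    show ?thesis using w ext[of w 0] by (intro exI[of _ "w(e := 0)"]) auto
  next
    case both
    then obtain a b where ab: "a \<in> C" "a e < 0" "b \<in> C" "0 < b e" by auto
    have C0_ne: "C0 \<noteq> {}" using mix[of a b, OF ab(2,4)] conv[OF ab(1,3)] by (auto simp: C0_def)
    have conv0: "(\<lambda>e. (1 - t) * x e + t * y e) \<in> C0" if "x \<in> C0" "y \<in> C0" "0 < t" "t < 1" for x y t
      using conv that by (auto simp: C0_def)
    have "\<not> (\<exists>x\<in>C0. \<forall>e\<in>E. x e = 0)" using insert.prems(3) by (auto simp: C0_def)
    from insert.IH[OF C0_ne conv0 this] obtain w where
      w: "\<forall>x\<in>C0. 0 \<le> (\<Sum>e\<in>E. w e * x e)" "\<exists>x\<in>C0. 0 < (\<Sum>e\<in>E. w e * x e)" by blast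
    define L where "L x = (\<Sum>e\<in>E. w e * x e)" for x
    \<comment> \<open>\<open>L\<close> is nonnegative at the crossing point of the segment. Hence
      each lower bound on the new weight, forced by a \<open>y\<close> with \<open>0 < y e\<close>,
      stays below each upper bound, forced by an \<open>x\<close> with
      \<open>x e < 0\<close>.\<close>
    have slopes: "- L y / y e \<le> L x / (- x e)" if xy: "x \<in> C" "x e < 0" "y \<in> C" "0 < y e" for x y
    proof -
      obtain t where t: "0 < t" "t < 1" "t * (y e - x e) = - x e" "(1 - t) * x e + t * y e = 0"
        using mix[of x y, OF xy(2,4)] by auto
      have "(\<lambda>e. (1 - t) * x e + t * y e) \<in> C0" using conv[OF xy(1,3) t(1,2)] t by (simp add: C0_def)
      hence "0 \<le> L (\<lambda>e. (1 - t) * x e + t * y e)" using w by (auto simp: L_def)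
      also have "\<dots> = (1 - t) * L x + t * L y"
        by (simp add: L_def algebra_simps sum.distrib sum_distrib_left sum_subtractf)
      finally have "0 \<le> ((1 - t) * L x + t * L y) * (y e - x e)" using xy by simp
      also have "\<dots> = (y e - x e - t * (y e - x e)) * L x + t * (y e - x e) * L y"
        by (simp add: algebra_simps)
      also have "\<dots> = y e * L x - x e * L y" unfolding t(3) by simp
      finally show ?thesis using xy by (simp add: field_simps)
    qed
    \<comment> \<open>The supremum of the lower bounds meets all constraints: \<open>b\<close> makes
      the index set nonempty and \<open>a\<close> bounds the slopes from above.\<close>
    define t where "t = (SUP y\<in>{y\<in>C. 0 < y e}. - L y / y e)"
    have bdd: "bdd_above ((\<lambda>y. - L y / y e) ` {y\<in>C. 0 < y e})"
      using slopes[OF ab(1,2)] by (intro bdd_aboveI2[where M = "L a / (- a e)"]) blast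
    have upper: "t \<le> L x / (- x e)" if "x \<in> C" "x e < 0" for x
      unfolding t_def using slopes[OF that] ab by (intro cSUP_least) auto
    have lower: "- L y / y e \<le> t" if "y \<in> C" "0 < y e" for y
      unfolding t_def using that by (intro cSUP_upper[OF _ bdd]) auto
    have "0 \<le> t * x e + L x" if "x \<in> C" for x
    proof -
      consider "x e < 0" | "x e = 0" | "0 < x e" by linarith
      thus ?thesis
      proof cases
        case 1 thus ?thesis using upper[OF that 1] by (simp add: field_simps)
      next
        case 2 thus ?thesis using w that by (simp add: C0_def L_def)
      next
        case 3 thus ?thesis using lower[OF that 3] by (simp add: field_simps)
      qed
    qed
    \<comment> \<open>Strictness comes from the slice, where the weight of \<open>e\<close> has no
      effect.\<close>
    moreover have "\<exists>x\<in>C. 0 < t * x e + L x"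
    proof -
      obtain x where "x \<in> C0" "0 < L x" using w(2) by (auto simp: L_def)
      thus ?thesis by (intro bexI[of _ x]) (auto simp: C0_def)
    qed
    ultimately show ?thesis by (intro exI[of _ "w(e := t)"]) (auto simp only: ext L_def)
  qed
qed

section \<open>Positive definite forms: duality and Cholesky factors\<close>

definition qform :: "nat \<Rightarrow> (nat \<Rightarrow> nat \<Rightarrow> real) \<Rightarrow> (nat \<Rightarrow> real) \<Rightarrow> real" where
  "qform m Y x = (\<Sum>i<m. \<Sum>j<m. x i * Y i j * x j)"

definition pos_def :: "nat \<Rightarrow> (nat \<Rightarrow> nat \<Rightarrow> real) \<Rightarrow> bool" where
  "pos_def m Y \<longleftrightarrow> (\<forall>i<m. \<forall>j<m. Y i j = Y j i) \<and> (\<forall>x. (\<exists>i<m. x i \<noteq> 0) \<longrightarrow> 0 < qform m Y x)"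

lemma qform_convex_combination:
  "qform m (\<lambda>i j. s * X i j + t * Y i j) x = s * qform m X x + t * qform m Y x"
  by (simp add: qform_def sum_distrib_left sum.distrib algebra_simps)

lemma pos_def_convex:
  assumes "pos_def m X" "pos_def m Y" "0 < t" "t < 1"
  shows "pos_def m (\<lambda>i j. (1 - t) * X i j + t * Y i j)"
  using assms by (simp add: pos_def_def qform_convex_combination add_pos_pos)

text \<open>The test matrices for the duality argument: sI + t x x^T stays inside the open cone, yet
  can tend to 0 or follow any boundary ray.\<close>

lemma pos_def_rank_one_update:
  assumes "0 < s" "0 \<le> t"
  shows "pos_def m (\<lambda>i j. s * (if i = j then 1 else 0) + t * (x i * x j))"
proof -
  have "0 < qform m (\<lambda>i j. s * (if i = j then 1 else 0) + t * (x i * x j)) y" if "i < m" "y i \<noteq> 0" for y i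
  proof -
    have "qform m (\<lambda>i j. s * (if i = j then 1 else 0) + t * (x i * x j)) y
      = (\<Sum>i<m. \<Sum>j<m. (if i = j then s * (y i * y j) else 0) + t * ((x i * y i) * (x j * y j)))"
      unfolding qform_def by (intro sum.cong) (auto simp: algebra_simps)
    also have "\<dots> = s * (\<Sum>i<m. (y i)\<^sup>2) + t * (\<Sum>i<m. x i * y i)\<^sup>2"
      unfolding power2_eq_square sum_product by (simp add: sum.distrib sum_distrib_left)
    also have "\<dots> > 0"
    proof -
      have "0 < (\<Sum>i<m. (y i)\<^sup>2)" using that by (intro sum_pos2[of _ i]) auto
      thus ?thesis using assms by (intro add_pos_nonneg) auto
    qed
    finally show ?thesis .
  qed
  thus ?thesis by (auto simp: pos_def_def)
qed

text \<open>A linear functional bounded below on a cone has a bound at most 0, by scaling towards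
  the origin, and is nonnegative on the cone. For semidefinite matrices the latter says that
  \<open>Z\<close> is semidefinite as well (self-duality).\<close>

lemma pairing_bounded_below:
  assumes "\<And>Y. pos_def m Y \<Longrightarrow> \<delta> \<le> (\<Sum>i<m. \<Sum>j<m. Z i j * Y i j)"
  shows "\<delta> \<le> 0" and "0 \<le> qform m Z x"
proof -
  have bound: "\<delta> \<le> s * (\<Sum>i<m. Z i i) + t * qform m Z x" if "0 < s" "0 \<le> t" for s t x
  proof -
    have "(\<Sum>i<m. \<Sum>j<m. Z i j * (s * (if i = j then 1 else 0) + t * (x i * x j)))
      = (\<Sum>i<m. \<Sum>j<m. (if i = j then s * Z i j else 0) + t * (x i * Z i j * x j))"
      by (intro sum.cong) (auto simp: algebra_simps)
    also have "\<dots> = s * (\<Sum>i<m. Z i i) + t * qform m Z x"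
      by (simp add: qform_def sum.distrib sum_distrib_left)
    finally show ?thesis using assms[OF pos_def_rank_one_update[OF that, of m x]] by simp
  qed
  show "\<delta> \<le> 0"
  proof (rule ccontr)
    assume \<delta>: "\<not> \<delta> \<le> 0"
    \<comment> \<open>The scale \<open>\<delta> / (2 * (\<bar>T\<bar> + 1))\<close> makes the
      pairing at most \<open>\<delta> / 2\<close>; the added 1 keeps the denominator positive when
      the trace is 0.\<close>
    define T where "T = (\<Sum>i<m. Z i i)"
    have "\<delta> \<le> \<delta> / (2 * (\<bar>T\<bar> + 1)) * T" using bound[of "\<delta> / (2 * (\<bar>T\<bar> + 1))" 0] \<delta> by (simp add: T_def)
    also have "\<dots> \<le> \<delta> / (2 * (\<bar>T\<bar> + 1)) * (\<bar>T\<bar> + 1)" using \<delta> by (intro mult_left_mono) auto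
    also have "\<dots> = \<delta> / 2" by (simp add: field_simps)
    finally show False using \<delta> by simp
  qed
  show "0 \<le> qform m Z x"
  proof (rule ccontr)
    assume neg: "\<not> 0 \<le> qform m Z x"
    define q where "q = qform m Z x"
    define T where "T = (\<Sum>i<m. Z i i)"
    \<comment> \<open>This \<open>t\<close> turns the bound \<open>\<delta> \<le> T + t * q\<close>
      into \<open>\<bar>T - \<delta>\<bar> + 1 \<le> T - \<delta>\<close>, which is
      impossible.\<close>
    define t where "t = (\<bar>T - \<delta>\<bar> + 1) / (- q)"
    have "t * q = - (\<bar>T - \<delta>\<bar> + 1)" "0 \<le> t" using neg by (auto simp: t_def q_def field_simps)
    thus False using bound[of 1 t x] by (simp add: T_def q_def)
  qed
qed

text \<open>Induction by eliminating the last index: the Schur complement \<open>S\<close> of the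
  entry \<open>d\<close> is again positive definite.\<close>

lemma cholesky:
  assumes "pos_def m Y"
  shows "\<exists>M. \<forall>i<m. \<forall>j<m. Y i j = (\<Sum>k<m. M i k * M j k)"
  using assms
proof (induction m arbitrary: Y)
  case 0
  thus ?case by simp
next
  case (Suc m)
  have sym: "Y i j = Y j i" if "i < Suc m" "j < Suc m" for i j
    using Suc.prems that by (auto simp: pos_def_def)
  have pos: "0 < qform (Suc m) Y x" if "i < Suc m" "x i \<noteq> 0" for i x
    using Suc.prems that by (auto simp: pos_def_def)
  define d where "d = Y m m"
  have "qform (Suc m) Y (\<lambda>i. if i = m then 1 else 0) = d" by (simp add: qform_def d_def)
  hence d: "0 < d" using pos[of m "\<lambda>i. if i = m then 1 else 0"] by simp
  define S where "S i j = Y i j - Y i m * Y j m / d" for i j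
  have "0 < qform m S x" if x: "i < m" "x i \<noteq> 0" for i x
  proof -
    define c where "c = (\<Sum>i<m. x i * Y i m)"
    \<comment> \<open>The last coordinate \<open>- c / d\<close> minimizes the form of
      \<open>Y\<close> over all extensions of \<open>x\<close>; completing the square shows that the
      minimum is the form of \<open>S\<close> at \<open>x\<close>.\<close>
    define z where "z = x(m := - c / d)"
    have row: "(\<Sum>j<m. Y m j * x j) = c" unfolding c_def using sym by (intro sum.cong) (auto simp: mult.commute)
    have "qform (Suc m) Y z = qform m Y x + c * z m + z m * c + d * (z m)\<^sup>2"
    proof -
      have "qform (Suc m) Y z = (\<Sum>i<m. (\<Sum>j<m. x i * Y i j * x j) + x i * Y i m * z m)
          + ((\<Sum>j<m. z m * (Y m j * x j)) + z m * d * z m)"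
        by (simp add: qform_def z_def d_def mult.assoc)
      also have "\<dots> = qform m Y x + c * z m + (z m * c + z m * d * z m)"
        unfolding sum.distrib sum_distrib_left[symmetric] row
        by (simp add: qform_def c_def sum_distrib_right)
      finally show ?thesis by (simp add: power2_eq_square)
    qed
    also have "\<dots> = qform m Y x - c\<^sup>2 / d" using d by (simp add: z_def power2_eq_square field_simps)
    also have "\<dots> = qform m S x"
      by (simp add: qform_def S_def c_def power2_eq_square sum_product sum_subtractf algebra_simps sum_divide_distrib)
    finally show ?thesis using pos[of i z] x by (simp add: z_def)
  qed
  moreover have "S i j = S j i" if "i < m" "j < m" for i j using sym that by (simp add: S_def)
  ultimately have "pos_def m S" unfolding pos_def_def by blast
  from Suc.IH[OF this] obtain M where M: "\<And>i j. i < m \<Longrightarrow> j < m \<Longrightarrow> S i j = (\<Sum>k<m. M i k * M j k)" by blast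
  \<comment> \<open>Column \<open>m\<close> restores the term subtracted in the Schur complement,
    and row \<open>m\<close> is zero elsewhere, so it contributes nothing to the first
    \<open>m\<close> columns.\<close>
  define M' where "M' i k = (if k = m then Y i m / sqrt d else if i = m then 0 else M i k)" for i k
  have "Y i j = (\<Sum>k<Suc m. M' i k * M' j k)" if ij: "i < Suc m" "j < Suc m" for i j
  proof -
    have last: "M' i m * M' j m = Y i m * Y j m / d" using d by (simp add: M'_def)
    show ?thesis
    proof (cases "i = m \<or> j = m")
      case True
      hence "(\<Sum>k<m. M' i k * M' j k) = 0" by (intro sum.neutral) (auto simp: M'_def)
      thus ?thesis using True last d sym[OF ij] by (auto simp: d_def)
    next
      case False
      hence "(\<Sum>k<m. M' i k * M' j k) = S i j" using M ij by (auto simp: M'_def intro!: sum.cong)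
      thus ?thesis using last by (simp add: S_def)
    qed
  qed
  thus ?case by blast
qed

section \<open>Rank and kernel\<close>

lemma rank_nullity_mat:
  assumes A: "A \<in> carrier_mat nr nc"
  shows "mat_rank A + vectorspace.dim class_ring ((module_vec TYPE(real) nc)\<lparr>carrier := mat_kernel A\<rparr>) = nc"
proof -
  interpret V: vec_space "TYPE(real)" nc .
  interpret W: vec_space "TYPE(real)" nr .
  interpret T: linear_map class_ring V.V W.V "(*\<^sub>v) A"
    apply unfold_locales
    unfolding LinearCombinations.module_hom_def using A
    by (auto simp: mult_add_distrib_mat_vec[OF A] mult_mat_vec[OF A] class_ring_simps module_vec_simps)
  have im: "T.imT = W.col_space A"
    unfolding W.col_space_eq[OF A] T.im_def using A by auto
  have ker: "T.kerT = mat_kernel A"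
    unfolding T.ker_def mat_kernel[OF A] by auto
  have "vectorspace.dim class_ring (W.vs T.imT) + vectorspace.dim class_ring (V.vs T.kerT) = V.dim"
    by (rule T.rank_nullity) simp
  thus ?thesis using A unfolding im ker by (auto simp: V.dim_is_n W.rank_def W.col_space_def)
qed

text \<open>The rank of a matrix whose columns span the kernel is the nullity. This keeps all later
  dimension counts in terms of \<open>mat_rank\<close> and numbers of columns.\<close>

lemma rank_add_rank_kernel:
  assumes A: "A \<in> carrier_mat nr nc" and B: "B \<in> carrier_mat nc d"
    and "column_space B = mat_kernel A"
  shows "mat_rank A + mat_rank B = nc"
  using rank_nullity_mat[OF A] assms(2,3)
  by (auto simp: vec_space.rank_def vec_space.col_space_def)

lemma column_space_eq:
  assumes A: "(A :: real mat) \<in> carrier_mat n d"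
  shows "column_space A = (\<lambda>x. A *\<^sub>v x) ` carrier_vec d"
proof -
  interpret W: vec_space "TYPE(real)" n .
  show ?thesis using W.col_space_eq[OF A] A by auto
qed

text \<open>By rank-nullity, full column rank means a kernel of dimension 0. Injectivity is the form
  used in all later arguments, and it covers matrices without columns.\<close>

lemma full_column_rank_iff:
  assumes A: "A \<in> carrier_mat n d"
  shows "full_column_rank A \<longleftrightarrow> (\<forall>x\<in>carrier_vec d. A *\<^sub>v x = 0\<^sub>v n \<longrightarrow> x = 0\<^sub>v d)"
proof -
  interpret kernel n d A by unfold_locales (rule A)
  obtain B where B: "finite B" "basis B" using kernel_basis_exists[OF A] by auto
  have dim: "dim = card B" using Ker.dim_basis[OF B] .
  have "full_column_rank A \<longleftrightarrow> dim = 0"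
    using rank_nullity_mat[OF A] A unfolding full_column_rank_def by auto
  also have "\<dots> \<longleftrightarrow> mat_kernel A = {0\<^sub>v d}"
  proof
    assume "dim = 0"
    hence "B = {}" using dim B by auto
    thus "mat_kernel A = {0\<^sub>v d}" using B unfolding Ker.basis_def
      using Ker.span_empty by auto
  next
    assume "mat_kernel A = {0\<^sub>v d}"
    hence "Ker.gen_set {}" using Ker.span_empty by auto
    thus "dim = 0" using Ker.gen_ge_dim[of "{}"] by auto
  qed
  also have "\<dots> \<longleftrightarrow> (\<forall>x\<in>carrier_vec d. A *\<^sub>v x = 0\<^sub>v n \<longrightarrow> x = 0\<^sub>v d)"
    using A unfolding mat_kernel[OF A] by auto
  finally show ?thesis .
qed

lemma full_column_rankD:
  assumes "full_column_rank A" "A \<in> carrier_mat n d" "x \<in> carrier_vec d" "A *\<^sub>v x = 0\<^sub>v n"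
  shows "x = 0\<^sub>v d"
  using assms full_column_rank_iff by blast

lemma kernel_basis_matrix:
  assumes A: "(A :: real mat) \<in> carrier_mat nr nc"
  obtains d B where "B \<in> carrier_mat nc d" "full_column_rank B" "column_space B = mat_kernel A"
proof -
  interpret kernel nr nc A by unfold_locales (rule A)
  obtain S where S: "finite S" "basis S" using kernel_basis_exists[OF A] by auto
  have dim: "dim = card S" using Ker.dim_basis[OF S] .
  obtain vs where vs: "set vs = S" "distinct vs" using finite_distinct_list[OF S(1)] by auto
  have SK: "S \<subseteq> mat_kernel A" "span S = mat_kernel A" using S unfolding Ker.basis_def by auto
  hence Sc: "S \<subseteq> carrier_vec nc" using mat_kernel_carrier[OF A] by auto
  let ?B = "mat_of_cols nc vs"
  have B: "?B \<in> carrier_mat nc (length vs)" by auto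
  have "cols ?B = vs" using Sc vs by (intro cols_mat_of_cols) auto
  hence cs: "column_space ?B = mat_kernel A"
    using span_same[OF SK(1)] SK vs by (simp add: vec_space.col_space_def)
  \<comment> \<open>Both the kernel dimension and the rank of \<open>?B\<close> complement
    \<open>mat_rank A\<close> to \<open>nc\<close>.\<close>
  have "mat_rank ?B = dim"
    using rank_nullity_mat[OF A] rank_add_rank_kernel[OF A B cs] by linarith
  hence "full_column_rank ?B" unfolding full_column_rank_def dim using vs distinct_card by force
  thus ?thesis using that[OF B _ cs] by simp
qed

section \<open>Orthogonality, concatenation and semidefinite matrices\<close>

lemma scalar_prod_self_eq_0:
  assumes "(x :: real vec) \<in> carrier_vec n" "x \<bullet> x = 0"
  shows "x = 0\<^sub>v n"
proof
  fix i assume i: "i < dim_vec (0\<^sub>v n)"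
  have "(\<Sum>i<n. x $ i * x $ i) = 0" using assms by (simp add: scalar_prod_def lessThan_atLeast0)
  hence "\<forall>i<n. x $ i * x $ i = 0" by (subst (asm) sum_nonneg_eq_0_iff) auto
  thus "x $ i = 0\<^sub>v n $ i" using i by auto
qed (use assms in auto)

lemma scalar_prod_self_nonneg: "0 \<le> (x :: real vec) \<bullet> x"
  by (simp add: scalar_prod_def sum_nonneg)

lemma eq_mat_vecI:
  fixes A B :: "real mat"
  assumes "A \<in> carrier_mat n m" "B \<in> carrier_mat n m"
    and "\<And>x. x \<in> carrier_vec m \<Longrightarrow> A *\<^sub>v x = B *\<^sub>v x"
  shows "A = B"
proof (rule mat_col_eqI)
  fix i assume "i < dim_col B"
  hence i: "i < m" using assms by auto
  have "M *\<^sub>v unit_vec m i = col M i" if "M \<in> carrier_mat n m" for M :: "real mat"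
    using that i by (intro eq_vecI) auto
  thus "col A i = col B i" using assms by (metis unit_vec_carrier)
qed (use assms in auto)

section \<open>Column concatenation and orthogonal projection\<close>

lemma carrier_vec_append_cases:
  assumes "(z :: 'a :: zero vec) \<in> carrier_vec (r + d)"
  obtains a c where "a \<in> carrier_vec r" "c \<in> carrier_vec d" "z = a @\<^sub>v c"
  using that[of "vec_first z r" "vec_last z d"] assms by auto

lemma hcat_carrier:
  assumes "A \<in> carrier_mat n r" "B \<in> carrier_mat n d"
  shows "hcat A B \<in> carrier_mat n (r + d)"
  using assms by (intro carrier_matI) (auto simp: hcat_def)

lemma hcat_index:
  assumes "A \<in> carrier_mat n r" "B \<in> carrier_mat n d" "i < n" "j < r + d"
  shows "hcat A B $$ (i, j) = (if j < r then A $$ (i, j) else B $$ (i, j - r))"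
  using assms by (auto simp: hcat_def mat_of_cols_index nth_append)

lemma hcat_mult_vec:
  fixes A B :: "real mat"
  assumes "A \<in> carrier_mat n r" "B \<in> carrier_mat n d" "a \<in> carrier_vec r" "c \<in> carrier_vec d"
  shows "hcat A B *\<^sub>v (a @\<^sub>v c) = A *\<^sub>v a + B *\<^sub>v c"
proof
  fix i assume "i < dim_vec (A *\<^sub>v a + B *\<^sub>v c)"
  hence i: "i < n" using assms by auto
  have row: "row (hcat A B) i = row A i @\<^sub>v row B i"
    using hcat_carrier[OF assms(1,2)] hcat_index[OF assms(1,2) i] assms(1,2) i by (intro eq_vecI) auto
  have "row A i \<in> carrier_vec r" "row B i \<in> carrier_vec d" using assms i by auto
  note sp = scalar_prod_append[OF this assms(3,4)]
  show "(hcat A B *\<^sub>v (a @\<^sub>v c)) $ i = (A *\<^sub>v a + B *\<^sub>v c) $ i"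
    using hcat_carrier[OF assms(1,2)] assms i by (simp add: row sp)
qed (use hcat_carrier[OF assms(1,2)] assms in auto)

lemma hcat_transpose_mult_vec:
  fixes A B :: "real mat"
  assumes "A \<in> carrier_mat n r" "B \<in> carrier_mat n d" "x \<in> carrier_vec n"
  shows "(hcat A B)\<^sup>T *\<^sub>v x = (A\<^sup>T *\<^sub>v x) @\<^sub>v (B\<^sup>T *\<^sub>v x)"
proof
  fix i assume "i < dim_vec ((A\<^sup>T *\<^sub>v x) @\<^sub>v (B\<^sup>T *\<^sub>v x))"
  hence i: "i < r + d" using assms by auto
  have "col (hcat A B) i = (if i < r then col A i else col B (i - r))"
    using hcat_carrier[OF assms(1,2)] hcat_index[OF assms(1,2) _ i] assms(1,2) i by (intro eq_vecI) auto
  thus "((hcat A B)\<^sup>T *\<^sub>v x) $ i = ((A\<^sup>T *\<^sub>v x) @\<^sub>v (B\<^sup>T *\<^sub>v x)) $ i"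
    using hcat_carrier[OF assms(1,2)] assms i by auto
qed (use hcat_carrier[OF assms(1,2)] assms in auto)

lemma square_injective_surjective:
  fixes M :: "real mat"
  assumes M: "M \<in> carrier_mat m m" and inj: "\<And>x. x \<in> carrier_vec m \<Longrightarrow> M *\<^sub>v x = 0\<^sub>v m \<Longrightarrow> x = 0\<^sub>v m"
    and y: "y \<in> carrier_vec m"
  obtains x where "x \<in> carrier_vec m" "M *\<^sub>v x = y"
proof -
  have "det M \<noteq> 0" using det_0_iff_vec_prod_zero[OF M] inj by blast
  from det_non_zero_imp_unit[OF M this, unfolded Units_def, of "()"]
  obtain N where N: "N \<in> carrier_mat m m" "M * N = 1\<^sub>m m" by (auto simp: ring_mat_def)
  have "M *\<^sub>v (N *\<^sub>v y) = y" using assoc_mult_mat_vec[OF M N(1) y] N(2) y by simp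
  thus ?thesis using that[of "N *\<^sub>v y"] N y by auto
qed

lemma transpose_scalar_prod:
  fixes A :: "real mat"
  assumes "A \<in> carrier_mat n d" "x \<in> carrier_vec n" "y \<in> carrier_vec d"
  shows "(A\<^sup>T *\<^sub>v x) \<bullet> y = x \<bullet> (A *\<^sub>v y)" "y \<bullet> (A\<^sup>T *\<^sub>v x) = (A *\<^sub>v y) \<bullet> x"
proof -
  show *: "(A\<^sup>T *\<^sub>v x) \<bullet> y = x \<bullet> (A *\<^sub>v y)" using transpose_vec_mult_scalar[OF assms(1,3,2)] .
  have "y \<bullet> (A\<^sup>T *\<^sub>v x) = (A\<^sup>T *\<^sub>v x) \<bullet> y" using assms by (intro comm_scalar_prod[of _ d]) auto
  also note *
  also have "x \<bullet> (A *\<^sub>v y) = (A *\<^sub>v y) \<bullet> x" using assms by (intro comm_scalar_prod[of _ n]) auto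
  finally show "y \<bullet> (A\<^sup>T *\<^sub>v x) = (A *\<^sub>v y) \<bullet> x" .
qed

text \<open>The square matrix \<open>A\<^sup>T * A\<close> is injective, since the squared norm of
  \<open>A *\<^sub>v x\<close> is its quadratic form at \<open>x\<close>; so it is onto. This serves
  both orthogonal projection and the construction of barycentric coefficients.\<close>

lemma gram_surjective:
  assumes A: "A \<in> carrier_mat n d" and f: "full_column_rank A" and y: "y \<in> carrier_vec d"
  obtains z where "z \<in> carrier_vec d" "A\<^sup>T *\<^sub>v (A *\<^sub>v z) = y"
proof -
  have AA: "A\<^sup>T * A \<in> carrier_mat d d" using A by auto
  have eq: "A\<^sup>T * A *\<^sub>v x = A\<^sup>T *\<^sub>v (A *\<^sub>v x)" if "x \<in> carrier_vec d" for x
    using A that by (intro assoc_mult_mat_vec) auto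
  have "x = 0\<^sub>v d" if x: "x \<in> carrier_vec d" "A\<^sup>T * A *\<^sub>v x = 0\<^sub>v d" for x
  proof -
    have "(A *\<^sub>v x) \<bullet> (A *\<^sub>v x) = (A\<^sup>T *\<^sub>v (A *\<^sub>v x)) \<bullet> x"
      using A x by (intro transpose_scalar_prod(1)[symmetric]) auto
    also have "\<dots> = 0" using x eq by simp
    finally have "A *\<^sub>v x = 0\<^sub>v n" using A x by (intro scalar_prod_self_eq_0) auto
    thus ?thesis using full_column_rankD[OF f A x(1)] by simp
  qed
  from square_injective_surjective[OF AA this y] obtain z where "z \<in> carrier_vec d" "A\<^sup>T * A *\<^sub>v z = y" by auto
  thus ?thesis using that eq by metis
qed

text \<open>The coefficients \<open>a\<close> solve the normal equations, so
  \<open>A *\<^sub>v a\<close> is the orthogonal projection of \<open>x\<close> onto the column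
  space.\<close>

lemma orthogonal_decomposition:
  assumes A: "A \<in> carrier_mat n d" and f: "full_column_rank A" and x: "x \<in> carrier_vec n"
  obtains a y where "a \<in> carrier_vec d" "y \<in> carrier_vec n" "x = A *\<^sub>v a + y" "A\<^sup>T *\<^sub>v y = 0\<^sub>v d"
proof -
  have "A\<^sup>T *\<^sub>v x \<in> carrier_vec d" using A x by auto
  from gram_surjective[OF A f this] obtain a where a: "a \<in> carrier_vec d" "A\<^sup>T *\<^sub>v (A *\<^sub>v a) = A\<^sup>T *\<^sub>v x" by auto
  have Aa: "A *\<^sub>v a \<in> carrier_vec n" using A a by auto
  have "A\<^sup>T *\<^sub>v (x - A *\<^sub>v a) = A\<^sup>T *\<^sub>v x - A\<^sup>T *\<^sub>v (A *\<^sub>v a)"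
    using A x Aa by (intro mult_minus_distrib_mat_vec) auto
  also have "\<dots> = 0\<^sub>v d" using A x by (simp add: a)
  finally have 1: "A\<^sup>T *\<^sub>v (x - A *\<^sub>v a) = 0\<^sub>v d" .
  have "x = A *\<^sub>v a + (x - A *\<^sub>v a)" 
    by (intro eq_vecI) (use x Aa carrier_vecD[OF x] carrier_vecD[OF Aa] in simp_all)
  thus ?thesis using that[of a "x - A *\<^sub>v a"] a 1 x Aa by auto
qed

text \<open>Pairing a vanishing combination with its \<open>A\<close> part removes the mixed term
  and leaves a squared norm equal to 0.\<close>

lemma hcat_full_column_rank:
  assumes A: "A \<in> carrier_mat n r" and B: "B \<in> carrier_mat n d"
    and f: "full_column_rank A" "full_column_rank B"
    and orth: "\<And>c. c \<in> carrier_vec d \<Longrightarrow> A\<^sup>T *\<^sub>v (B *\<^sub>v c) = 0\<^sub>v r"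
  shows "full_column_rank (hcat A B)"
  unfolding full_column_rank_iff[OF hcat_carrier[OF A B]]
proof (intro ballI impI)
  fix z assume z: "z \<in> carrier_vec (r + d)" "hcat A B *\<^sub>v z = 0\<^sub>v n"
  obtain a c where ac: "a \<in> carrier_vec r" "c \<in> carrier_vec d" "z = a @\<^sub>v c"
    using carrier_vec_append_cases[OF z(1)] .
  have Aa: "A *\<^sub>v a \<in> carrier_vec n" and Bc: "B *\<^sub>v c \<in> carrier_vec n" using A B ac by auto
  have sum0: "A *\<^sub>v a + B *\<^sub>v c = 0\<^sub>v n" using z(2) hcat_mult_vec[OF A B ac(1,2)] ac(3) by simp
  have "(A *\<^sub>v a) \<bullet> (B *\<^sub>v c) = a \<bullet> (A\<^sup>T *\<^sub>v (B *\<^sub>v c))"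
    using transpose_scalar_prod(2)[OF A Bc ac(1)] by simp
  hence 0: "(A *\<^sub>v a) \<bullet> (B *\<^sub>v c) = 0" using orth[OF ac(2)] ac by simp
  have "(A *\<^sub>v a) \<bullet> (A *\<^sub>v a) + (A *\<^sub>v a) \<bullet> (B *\<^sub>v c) = (A *\<^sub>v a) \<bullet> 0\<^sub>v n"
    unfolding sum0[symmetric] by (rule scalar_prod_add_distrib[symmetric, OF Aa Aa Bc])
  hence "A *\<^sub>v a = 0\<^sub>v n" using 0 Aa by (intro scalar_prod_self_eq_0) auto
  moreover from this have "B *\<^sub>v c = 0\<^sub>v n" using sum0 Bc by simp
  ultimately show "z = 0\<^sub>v (r + d)"
    using full_column_rankD[OF f(1) A ac(1)] full_column_rankD[OF f(2) B ac(2)] ac(3)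
    by (intro eq_vecI) auto
qed

lemma full_column_rank_mult:
  assumes A: "A \<in> carrier_mat n d" and B: "B \<in> carrier_mat d d'" and f: "full_column_rank A" "full_column_rank B"
  shows "full_column_rank (A * B)"
proof -
  have AB: "A * B \<in> carrier_mat n d'" using A B by auto
  have "x = 0\<^sub>v d'" if x: "x \<in> carrier_vec d'" "A * B *\<^sub>v x = 0\<^sub>v n" for x
  proof -
    have "A *\<^sub>v (B *\<^sub>v x) = 0\<^sub>v n" using assoc_mult_mat_vec[OF A B x(1)] x by simp
    hence "B *\<^sub>v x = 0\<^sub>v d" using B x by (intro full_column_rankD[OF f(1) A]) auto
    thus ?thesis using full_column_rankD[OF f(2) B x(1)] by simp
  qed
  thus ?thesis using full_column_rank_iff[OF AB] by auto
qed

section \<open>Congruences and isotropic vectors\<close>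

lemma congruence_scalar_prod:
  fixes A W :: "real mat"
  assumes A: "A \<in> carrier_mat n d" and B: "B \<in> carrier_mat n d'" and W: "W \<in> carrier_mat n n"
    and x: "x \<in> carrier_vec d" and y: "y \<in> carrier_vec d'"
  shows "(A\<^sup>T * W * B) *\<^sub>v y = A\<^sup>T *\<^sub>v (W *\<^sub>v (B *\<^sub>v y))"
    and "x \<bullet> ((A\<^sup>T * W * B) *\<^sub>v y) = (A *\<^sub>v x) \<bullet> (W *\<^sub>v (B *\<^sub>v y))"
proof -
  have AT: "A\<^sup>T \<in> carrier_mat d n" and By: "B *\<^sub>v y \<in> carrier_vec n" using A B y by auto
  have "(A\<^sup>T * W * B) *\<^sub>v y = (A\<^sup>T * W) *\<^sub>v (B *\<^sub>v y)"
    using AT W by (intro assoc_mult_mat_vec[OF _ B y]) auto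
  also have "\<dots> = A\<^sup>T *\<^sub>v (W *\<^sub>v (B *\<^sub>v y))" by (rule assoc_mult_mat_vec[OF AT W By])
  finally show *: "(A\<^sup>T * W * B) *\<^sub>v y = A\<^sup>T *\<^sub>v (W *\<^sub>v (B *\<^sub>v y))" .
  show "x \<bullet> ((A\<^sup>T * W * B) *\<^sub>v y) = (A *\<^sub>v x) \<bullet> (W *\<^sub>v (B *\<^sub>v y))"
    unfolding * using W By by (intro transpose_scalar_prod(2)[OF A _ x]) auto
qed

lemma psdD:
  assumes "psd A" "A \<in> carrier_mat n n"
  shows "A\<^sup>T = A" "x \<in> carrier_vec n \<Longrightarrow> 0 \<le> x \<bullet> (A *\<^sub>v x)"
  using assms by (auto simp: psd_def)

lemma symmetric_scalar_prod:
  fixes A :: "real mat"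
  assumes "A \<in> carrier_mat n n" "A\<^sup>T = A" "x \<in> carrier_vec n" "y \<in> carrier_vec n"
  shows "x \<bullet> (A *\<^sub>v y) = y \<bullet> (A *\<^sub>v x)"
proof -
  have "x \<bullet> (A *\<^sub>v y) = (A *\<^sub>v x) \<bullet> y" using transpose_scalar_prod(1)[OF assms(1,3,4)] assms(2) by simp
  also have "\<dots> = y \<bullet> (A *\<^sub>v x)" using assms by (intro comm_scalar_prod[of _ n]) auto
  finally show ?thesis .
qed

text \<open>Along the line through \<open>x\<close> in direction \<open>g = A *\<^sub>v x\<close>
  the form is a nonnegative quadratic in \<open>t\<close> without constant term, so its linear
  coefficient, twice the squared norm of \<open>g\<close>, must vanish.\<close>

lemma psd_isotropic_imp_kernel:
  assumes A: "A \<in> carrier_mat n n" and p: "psd A" and x: "x \<in> carrier_vec n" and 0: "x \<bullet> (A *\<^sub>v x) = 0"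
  shows "A *\<^sub>v x = 0\<^sub>v n"
proof -
  define g where "g = A *\<^sub>v x"
  have g: "g \<in> carrier_vec n" using A x by (auto simp: g_def)
  define b where "b = g \<bullet> g"
  define h where "h = g \<bullet> (A *\<^sub>v g)"
  have h: "0 \<le> h" unfolding h_def using psdD[OF p A] g by auto
  have gx: "x \<bullet> (A *\<^sub>v g) = b"
    using symmetric_scalar_prod[OF A psdD(1)[OF p A] x g] by (simp add: b_def g_def)
  have quad: "0 \<le> 2 * t * b + t\<^sup>2 * h" for t
  proof -
    have tg: "t \<cdot>\<^sub>v g \<in> carrier_vec n" and Ag: "A *\<^sub>v g \<in> carrier_vec n" using g A by auto
    have "A *\<^sub>v (x + t \<cdot>\<^sub>v g) = g + t \<cdot>\<^sub>v (A *\<^sub>v g)"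
      using mult_add_distrib_mat_vec[OF A x tg] mult_mat_vec[OF A g] by (simp add: g_def)
    hence "(x + t \<cdot>\<^sub>v g) \<bullet> (A *\<^sub>v (x + t \<cdot>\<^sub>v g)) = (x + t \<cdot>\<^sub>v g) \<bullet> (g + t \<cdot>\<^sub>v (A *\<^sub>v g))" by simp
    also have "\<dots> = x \<bullet> g + t * (x \<bullet> (A *\<^sub>v g)) + (t * (g \<bullet> g) + t * (t * h))"
      using x g tg Ag by (simp add: add_scalar_prod_distrib[of _ n] scalar_prod_add_distrib[of _ n] h_def algebra_simps)
    also have "\<dots> = 2 * t * b + t\<^sup>2 * h" using 0 by (simp add: gx b_def g_def[symmetric] power2_eq_square)
    finally show ?thesis using psdD(2)[OF p A, of "x + t \<cdot>\<^sub>v g"] x tg by simp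
  qed
  have "b = 0"
  proof (rule ccontr)
    assume "b \<noteq> 0"
    hence b: "0 < b" using scalar_prod_self_nonneg[of g] by (simp add: b_def)
    \<comment> \<open>At \<open>t = - u\<close> the quadratic equals
      \<open>- (u\<^sup>2 * (h + 2))\<close>. Dividing by \<open>h + 1\<close> also serves the case
      \<open>h = 0\<close>.\<close>
    define u where "u = b / (h + 1)"
    have "b = u * (h + 1)" "u \<noteq> 0" using b h by (auto simp: u_def)
    hence "2 * (- u) * b + (- u)\<^sup>2 * h = - (u\<^sup>2 * (h + 2))"
      by (simp add: power2_eq_square algebra_simps)
    moreover have "0 < u\<^sup>2 * (h + 2)" using h \<open>u \<noteq> 0\<close> by (intro mult_pos_pos) auto
    ultimately show False using quad[of "- u"] by simp
  qed
  thus ?thesis using scalar_prod_self_eq_0[OF g] by (simp add: b_def g_def)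
qed

section \<open>Configuration matrices\<close>

lemma scalar_prod_mult_mat_vec:
  fixes A :: "real mat"
  assumes "A \<in> carrier_mat n m" "x \<in> carrier_vec n" "y \<in> carrier_vec m"
  shows "x \<bullet> (A *\<^sub>v y) = (\<Sum>a<n. \<Sum>b<m. x $ a * A $$ (a, b) * y $ b)"
  using assms by (simp add: scalar_prod_def lessThan_atLeast0 sum_distrib_left mult.assoc)

lemma sq_dist_eq:
  assumes "x \<in> carrier_vec s" "y \<in> carrier_vec s"
  shows "sq_dist x y = (\<Sum>k<s. (x $ k - y $ k)\<^sup>2)"
  using assms by (simp add: sq_dist_def scalar_prod_def lessThan_atLeast0 power2_eq_square)

lemma configuration_matrix_carrier [simp]: "configuration_matrix n r p \<in> carrier_mat n r"
  unfolding configuration_matrix_def by (intro carrier_matI) auto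

lemma configuration_matrix_index:
  "i < n \<Longrightarrow> j < r \<Longrightarrow> configuration_matrix n r p $$ (i, j) = p i $ j"
  by (simp add: configuration_matrix_def mat_of_rows_index)

lemma affine_span_scalar_prod:
  assumes p: "\<And>i. i < n \<Longrightarrow> p i \<in> carrier_vec r" and z: "z \<in> carrier_vec r"
  shows "vec r (\<lambda>j. \<Sum>i<n. c i * p i $ j) \<bullet> z = (\<Sum>i<n. c i * (p i \<bullet> z))"
proof -
  have "vec r (\<lambda>j. \<Sum>i<n. c i * p i $ j) \<bullet> z = (\<Sum>j<r. \<Sum>i<n. c i * (p i $ j * z $ j))"
    using z by (simp add: scalar_prod_def lessThan_atLeast0 sum_distrib_right mult.assoc)
  also have "\<dots> = (\<Sum>i<n. c i * (\<Sum>j<r. p i $ j * z $ j))"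
    by (subst sum.swap) (simp add: sum_distrib_left)
  also have "\<dots> = (\<Sum>i<n. c i * (p i \<bullet> z))"
    using z by (simp add: scalar_prod_def lessThan_atLeast0)
  finally show ?thesis .
qed

text \<open>A linear functional constant on the points is constant on their affine span, here the
  whole space; comparing its values at \<open>z\<close> and at 0 gives
  \<open>z \<bullet> z = 0\<close>.\<close>

lemma affinely_spanning_imp_not_in_hyperplane:
  assumes span: "affine_span n r p = carrier_vec r" and p: "\<And>i. i < n \<Longrightarrow> p i \<in> carrier_vec r"
    and z: "z \<in> carrier_vec r" and const: "\<And>i. i < n \<Longrightarrow> p i \<bullet> z = \<gamma>"
  shows "z = 0\<^sub>v r"
proof -
  have val: "y \<bullet> z = \<gamma>" if "y \<in> carrier_vec r" for y
  proof -
    have "y \<in> affine_span n r p" using that span by simp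
    then obtain c where c: "y = vec r (\<lambda>j. \<Sum>i<n. c i * p i $ j)" "(\<Sum>i<n. c i) = 1"
      unfolding affine_span_def by blast
    have "y \<bullet> z = (\<Sum>i<n. c i * (p i \<bullet> z))" unfolding c(1) by (rule affine_span_scalar_prod[OF p z])
    also have "\<dots> = (\<Sum>i<n. c i * \<gamma>)" using const by simp
    also have "\<dots> = \<gamma>" using c(2) by (simp add: sum_distrib_right[symmetric])
    finally show ?thesis .
  qed
  have "z \<bullet> z = 0\<^sub>v r \<bullet> z" using val z by (metis zero_carrier_vec)
  thus ?thesis using z by (intro scalar_prod_self_eq_0) auto
qed

lemma configuration_matrix_full_column_rank:
  assumes "dim_framework n r G p"
  shows "full_column_rank (configuration_matrix n r p)"
  unfolding full_column_rank_iff[OF configuration_matrix_carrier]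
proof (intro ballI impI)
  fix z assume z: "z \<in> carrier_vec r" "configuration_matrix n r p *\<^sub>v z = 0\<^sub>v n"
  have p: "\<And>i. i < n \<Longrightarrow> p i \<in> carrier_vec r" and span: "affine_span n r p = carrier_vec r"
    using assms by (auto simp: dim_framework_def bar_framework_def)
  have "p i \<bullet> z = 0" if "i < n" for i
  proof -
    have "row (configuration_matrix n r p) i = p i"
      using p[OF that] that configuration_matrix_index[of i n _ r p] carrier_matD[OF configuration_matrix_carrier[of n r p]]
      by (intro eq_vecI) auto
    hence "(configuration_matrix n r p *\<^sub>v z) $ i = p i \<bullet> z"
      using that configuration_matrix_carrier[of n r p] by (metis index_mult_mat_vec carrier_matD(1))
    thus ?thesis using z that by simp
  qed
  thus "z = 0\<^sub>v r"
    by (intro affinely_spanning_imp_not_in_hyperplane[OF span _ z(1), where \<gamma> = 0]) (use p in auto)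
qed

section \<open>The space T of coordinate vectors of affine images of the configuration\<close>

definition affine_matrix :: "real mat \<Rightarrow> real mat" where
  "affine_matrix P = hcat P (mat (dim_row P) 1 (\<lambda>_. 1))"

lemma ones_matrix_mult_vec:
  "b \<in> carrier_vec 1 \<Longrightarrow> mat n 1 (\<lambda>_. 1) *\<^sub>v b = b $ 0 \<cdot>\<^sub>v ones_vec n"
  by (intro eq_vecI) (auto simp: scalar_prod_def)

lemma ones_matrix_transpose_mult_vec:
  "x \<in> carrier_vec n \<Longrightarrow> (mat n 1 (\<lambda>_. 1))\<^sup>T *\<^sub>v x = vec 1 (\<lambda>_. ones_vec n \<bullet> x)"
  by (intro eq_vecI) (auto simp: scalar_prod_def)

lemma ones_matrix_full_column_rank:
  assumes "0 < n"
  shows "full_column_rank (mat n 1 (\<lambda>_. 1))"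
proof -
  have "b = 0\<^sub>v 1" if "b \<in> carrier_vec 1" "mat n 1 (\<lambda>_. 1) *\<^sub>v b = 0\<^sub>v n" for b :: "real vec"
  proof -
    have "b $ 0 \<cdot>\<^sub>v ones_vec n = 0\<^sub>v n" using that(2) unfolding ones_matrix_mult_vec[OF that(1)] .
    from arg_cong[OF this, of "\<lambda>v. v $ 0"] have "b $ 0 = 0" using assms by simp
    thus ?thesis using that(1) assms by (intro eq_vecI) auto
  qed
  thus ?thesis using full_column_rank_iff[of "mat n 1 (\<lambda>_. 1)" n 1] by auto
qed

lemma affine_matrix_carrier:
  assumes "P \<in> carrier_mat n r"
  shows "affine_matrix P \<in> carrier_mat n (r + 1)"
  unfolding affine_matrix_def using assms by (intro hcat_carrier) auto

lemma affine_matrix_mult_vec: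
  assumes "P \<in> carrier_mat n r" "a \<in> carrier_vec r" "b \<in> carrier_vec 1"
  shows "affine_matrix P *\<^sub>v (a @\<^sub>v b) = P *\<^sub>v a + b $ 0 \<cdot>\<^sub>v ones_vec n"
  unfolding affine_matrix_def using assms ones_matrix_mult_vec[OF assms(3), of n]
  by (subst hcat_mult_vec[OF assms(1) _ assms(2,3)]) auto

lemma affine_matrix_transpose_mult_vec:
  assumes "P \<in> carrier_mat n r" "x \<in> carrier_vec n"
  shows "(affine_matrix P)\<^sup>T *\<^sub>v x = (P\<^sup>T *\<^sub>v x) @\<^sub>v vec 1 (\<lambda>_. ones_vec n \<bullet> x)"
  unfolding affine_matrix_def using assms ones_matrix_transpose_mult_vec[OF assms(2)]
  by (subst hcat_transpose_mult_vec[OF assms(1) _ assms(2)]) auto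

lemma affine_matrix_transpose_eq_0_iff:
  assumes "P \<in> carrier_mat n r" "x \<in> carrier_vec n"
  shows "(affine_matrix P)\<^sup>T *\<^sub>v x = 0\<^sub>v (r + 1) \<longleftrightarrow> P\<^sup>T *\<^sub>v x = 0\<^sub>v r \<and> ones_vec n \<bullet> x = 0"
proof -
  have "0\<^sub>v (r + 1) = 0\<^sub>v r @\<^sub>v (0\<^sub>v 1 :: real vec)" by (intro eq_vecI) auto
  moreover have "vec 1 (\<lambda>_. c) = 0\<^sub>v 1 \<longleftrightarrow> c = (0 :: real)" for c
    by (metis index_vec index_zero_vec(1) less_one zero_vec_def)
  ultimately show ?thesis unfolding affine_matrix_transpose_mult_vec[OF assms]
    using assms by (simp add: append_vec_eq[of _ r])
qed

text \<open>Centering says that the all-ones column is orthogonal to the columns of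
  \<open>P\<close>, so independence follows from orthogonality.\<close>

lemma affine_matrix_full_column_rank:
  assumes P: "P \<in> carrier_mat n r" and f: "full_column_rank P"
    and centered: "P\<^sup>T *\<^sub>v ones_vec n = 0\<^sub>v r" and n: "0 < n"
  shows "full_column_rank (affine_matrix P)"
proof -
  have "P\<^sup>T *\<^sub>v (mat n 1 (\<lambda>_. 1) *\<^sub>v c) = 0\<^sub>v r" if c: "c \<in> carrier_vec 1" for c
  proof -
    have "P\<^sup>T *\<^sub>v (c $ 0 \<cdot>\<^sub>v ones_vec n) = c $ 0 \<cdot>\<^sub>v (P\<^sup>T *\<^sub>v ones_vec n)"
      using P by (intro mult_mat_vec[of _ r n]) auto
    moreover have "c $ 0 \<cdot>\<^sub>v 0\<^sub>v r = 0\<^sub>v r" by (intro eq_vecI) auto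
    ultimately show ?thesis unfolding ones_matrix_mult_vec[OF c] centered by simp
  qed
  hence "full_column_rank (hcat P (mat n 1 (\<lambda>_. 1)))"
    by (intro hcat_full_column_rank[OF P _ f ones_matrix_full_column_rank[OF n]]) auto
  thus ?thesis unfolding affine_matrix_def using P by simp
qed

text \<open>Identifies the space spanned by \<open>\<rho> 1\<close>: the part of the kernel of the
  stress that is orthogonal to T.\<close>

lemma stacked_kernel_eq:
  assumes W: "W \<in> carrier_mat n n" and P: "P \<in> carrier_mat n r"
  shows "mat_kernel (W @\<^sub>r P\<^sup>T @\<^sub>r mat_of_row (ones_vec n))
    = {x \<in> carrier_vec n. W *\<^sub>v x = 0\<^sub>v n \<and> (affine_matrix P)\<^sup>T *\<^sub>v x = 0\<^sub>v (r + 1)}"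
proof -
  have PT: "P\<^sup>T \<in> carrier_mat r n" and row: "mat_of_row (ones_vec n) \<in> carrier_mat 1 n" using P by auto
  have tail: "P\<^sup>T @\<^sub>r mat_of_row (ones_vec n) \<in> carrier_mat (r + 1) n" by (rule carrier_append_rows[OF PT row])
  have "(W @\<^sub>r P\<^sup>T @\<^sub>r mat_of_row (ones_vec n)) *\<^sub>v x = 0\<^sub>v (n + (r + 1)) \<longleftrightarrow>
      W *\<^sub>v x = 0\<^sub>v n \<and> (affine_matrix P)\<^sup>T *\<^sub>v x = 0\<^sub>v (r + 1)" if x: "x \<in> carrier_vec n" for x
  proof -
    have "mat_of_row (ones_vec n) *\<^sub>v x = vec 1 (\<lambda>_. ones_vec n \<bullet> x)"
      using x by (intro eq_vecI) (auto simp: scalar_prod_def)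
    hence "(W @\<^sub>r P\<^sup>T @\<^sub>r mat_of_row (ones_vec n)) *\<^sub>v x = (W *\<^sub>v x) @\<^sub>v ((affine_matrix P)\<^sup>T *\<^sub>v x)"
      by (simp add: mat_mult_append[OF W tail x] mat_mult_append[OF PT row x] affine_matrix_transpose_mult_vec[OF P x])
    moreover have "0\<^sub>v (n + (r + 1)) = 0\<^sub>v n @\<^sub>v (0\<^sub>v (r + 1) :: real vec)" by (intro eq_vecI) auto
    ultimately show ?thesis using W x by (simp add: append_vec_eq[of _ n])
  qed
  thus ?thesis unfolding mat_kernel[OF carrier_append_rows[OF W tail]] by auto
qed

section \<open>Quasi-stresses\<close>

text \<open>Collects the algebraic conditions on a quasi-stress and leaves the graph aside; the
  support condition enters through \<open>quasi_stress_energy_eq_0\<close>.\<close>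

locale configuration_stress =
  fixes n r :: nat and P W :: "real mat"
  assumes P: "P \<in> carrier_mat n r"
    and W: "W \<in> carrier_mat n n"
    and W_sym: "W\<^sup>T = W"
    and W_ones: "W *\<^sub>v ones_vec n = 0\<^sub>v n"
    and P_W_P: "P\<^sup>T * W * P = 0\<^sub>m r r"
begin

abbreviation T :: "real mat" where "T \<equiv> affine_matrix P"

lemma T: "T \<in> carrier_mat n (r + 1)"
  using affine_matrix_carrier[OF P] .

lemma ones_scalar_prod_W:
  assumes "x \<in> carrier_vec n"
  shows "ones_vec n \<bullet> (W *\<^sub>v x) = 0"
  using symmetric_scalar_prod[OF W W_sym _ assms, of "ones_vec n"] W_ones assms by simp

text \<open>The condition on \<open>P\<close> extends to \<open>T\<close> because the rows of
  \<open>W\<close> are orthogonal to the all-ones vector. With \<open>B = P\<close> it also shows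
  that \<open>T\<^sup>T * W * T\<close> vanishes.\<close>

lemma T_W_mult_vec:
  assumes B: "B \<in> carrier_mat n d" and 0: "P\<^sup>T * W * B = 0\<^sub>m r d" and c: "c \<in> carrier_vec d"
  shows "T\<^sup>T *\<^sub>v (W *\<^sub>v (B *\<^sub>v c)) = 0\<^sub>v (r + 1)"
proof -
  have Bc: "B *\<^sub>v c \<in> carrier_vec n" and WBc: "W *\<^sub>v (B *\<^sub>v c) \<in> carrier_vec n" using B W c by auto
  have "P\<^sup>T *\<^sub>v (W *\<^sub>v (B *\<^sub>v c)) = 0\<^sub>m r d *\<^sub>v c"
    using congruence_scalar_prod(1)[OF P B W _ c, of "0\<^sub>v r"] 0 by simp
  also have "\<dots> = 0\<^sub>v r" using c by (intro eq_vecI) auto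
  finally show ?thesis
    unfolding affine_matrix_transpose_eq_0_iff[OF P WBc] using ones_scalar_prod_W[OF Bc] by simp
qed

lemma W_T_mult_vec:
  assumes "a \<in> carrier_vec r" "b \<in> carrier_vec 1"
  shows "W *\<^sub>v (T *\<^sub>v (a @\<^sub>v b)) = W *\<^sub>v (P *\<^sub>v a)"
proof -
  have Pa: "P *\<^sub>v a \<in> carrier_vec n" using P assms by auto
  have "W *\<^sub>v (T *\<^sub>v (a @\<^sub>v b)) = W *\<^sub>v (P *\<^sub>v a) + b $ 0 \<cdot>\<^sub>v (W *\<^sub>v ones_vec n)"
    unfolding affine_matrix_mult_vec[OF P assms]
    using mult_add_distrib_mat_vec[OF W Pa, of "b $ 0 \<cdot>\<^sub>v ones_vec n"] mult_mat_vec[OF W, of "ones_vec n"] by simp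
  also have "b $ 0 \<cdot>\<^sub>v (W *\<^sub>v ones_vec n) = 0\<^sub>v n" unfolding W_ones by (intro eq_vecI) auto
  also have "W *\<^sub>v (P *\<^sub>v a) + 0\<^sub>v n = W *\<^sub>v (P *\<^sub>v a)" using W Pa by simp
  finally show ?thesis .
qed

lemma T_W_T_mult_vec:
  assumes "a \<in> carrier_vec (r + 1)"
  shows "T\<^sup>T *\<^sub>v (W *\<^sub>v (T *\<^sub>v a)) = 0\<^sub>v (r + 1)"
proof -
  obtain a' b where ab: "a' \<in> carrier_vec r" "b \<in> carrier_vec 1" "a = a' @\<^sub>v b"
    using carrier_vec_append_cases[OF assms] .
  show ?thesis unfolding ab(3) W_T_mult_vec[OF ab(1,2)] by (rule T_W_mult_vec[OF P P_W_P ab(1)])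
qed

text \<open>The T-block and the mixed terms vanish, so on the sum of T and the column space of
  \<open>B\<close> the energy sees only the coefficients \<open>c\<close>.\<close>

lemma quadratic_form_decompose:
  assumes B: "B \<in> carrier_mat n d" and 0: "P\<^sup>T * W * B = 0\<^sub>m r d"
    and a: "a \<in> carrier_vec (r + 1)" and c: "c \<in> carrier_vec d"
  shows "(T *\<^sub>v a + B *\<^sub>v c) \<bullet> (W *\<^sub>v (T *\<^sub>v a + B *\<^sub>v c)) = c \<bullet> ((B\<^sup>T * W * B) *\<^sub>v c)"
proof -
  let ?x = "T *\<^sub>v a" and ?y = "B *\<^sub>v c"
  have x: "?x \<in> carrier_vec n" and y: "?y \<in> carrier_vec n" using T B a c by auto
  have Wx: "W *\<^sub>v ?x \<in> carrier_vec n" and Wy: "W *\<^sub>v ?y \<in> carrier_vec n" using W x y by auto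
  have xWx: "?x \<bullet> (W *\<^sub>v ?x) = 0"
    using transpose_scalar_prod(2)[OF T Wx a] T_W_T_mult_vec[OF a] a by simp
  have xWy: "?x \<bullet> (W *\<^sub>v ?y) = 0"
    using transpose_scalar_prod(2)[OF T Wy a] T_W_mult_vec[OF B 0 c] a by simp
  have yWx: "?y \<bullet> (W *\<^sub>v ?x) = 0" using symmetric_scalar_prod[OF W W_sym y x] xWy by simp
  have "(?x + ?y) \<bullet> (W *\<^sub>v (?x + ?y)) = ?y \<bullet> (W *\<^sub>v ?y)"
    using mult_add_distrib_mat_vec[OF W x y] x y Wx Wy xWx xWy yWx
    by (simp add: add_scalar_prod_distrib[of _ n] scalar_prod_add_distrib[of _ n])
  thus ?thesis using congruence_scalar_prod(2)[OF B B W c c] by simp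
qed

lemma congruence_transpose:
  assumes A: "A \<in> carrier_mat n d" and B: "B \<in> carrier_mat n d'"
  shows "(A\<^sup>T * W * B)\<^sup>T = B\<^sup>T * W * A"
proof -
  have AT: "A\<^sup>T \<in> carrier_mat d n" and BT: "B\<^sup>T \<in> carrier_mat d' n" using A B by auto
  have "(A\<^sup>T * W * B)\<^sup>T = B\<^sup>T * (A\<^sup>T * W)\<^sup>T"
    using AT W by (intro transpose_mult[OF _ B]) auto
  also have "(A\<^sup>T * W)\<^sup>T = W * A" using transpose_mult[OF AT W] W_sym by simp
  also have "B\<^sup>T * (W * A) = B\<^sup>T * W * A" by (rule assoc_mult_mat[symmetric, OF BT W A])
  finally show ?thesis .
qed

lemma congruence_symmetric:
  assumes B: "B \<in> carrier_mat n d"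
  shows "B\<^sup>T * W * B \<in> carrier_mat d d" "(B\<^sup>T * W * B)\<^sup>T = B\<^sup>T * W * B"
  using B W congruence_transpose[OF B B] by auto

text \<open>With \<open>U = hcat P B\<close>, this is the block form diag(0,
  \<open>B\<^sup>T * W * B\<close>) of \<open>U\<^sup>T * W * U\<close>, expressed by its action on
  split vectors.\<close>

lemma hcat_congruence_mult_vec:
  assumes B: "B \<in> carrier_mat n d" and 0: "P\<^sup>T * W * B = 0\<^sub>m r d"
    and a: "a \<in> carrier_vec r" and c: "c \<in> carrier_vec d"
  shows "((hcat P B)\<^sup>T * W * hcat P B) *\<^sub>v (a @\<^sub>v c) = 0\<^sub>v r @\<^sub>v ((B\<^sup>T * W * B) *\<^sub>v c)"
proof -
  let ?U = "hcat P B"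
  have U: "?U \<in> carrier_mat n (r + d)" using hcat_carrier[OF P B] .
  have Pa: "P *\<^sub>v a \<in> carrier_vec n" and Bc: "B *\<^sub>v c \<in> carrier_vec n" using P B a c by auto
  have WPa: "W *\<^sub>v (P *\<^sub>v a) \<in> carrier_vec n" and WBc: "W *\<^sub>v (B *\<^sub>v c) \<in> carrier_vec n" using W Pa Bc by auto
  have BT: "B\<^sup>T \<in> carrier_mat d n" and PT: "P\<^sup>T \<in> carrier_mat r n" using B P by auto
  have BWP: "B\<^sup>T * W * P = 0\<^sub>m d r" using congruence_transpose[OF P B] 0 by simp
  have zero: "0\<^sub>m m k *\<^sub>v v = 0\<^sub>v m" if "v \<in> carrier_vec k" for m k and v :: "real vec"
    using that by (intro eq_vecI) auto
  have PWP: "P\<^sup>T *\<^sub>v (W *\<^sub>v (P *\<^sub>v a)) = 0\<^sub>v r"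
    using congruence_scalar_prod(1)[OF P P W a a] P_W_P zero[OF a] by simp
  have PWB: "P\<^sup>T *\<^sub>v (W *\<^sub>v (B *\<^sub>v c)) = 0\<^sub>v r"
    using congruence_scalar_prod(1)[OF P B W a c] 0 zero[OF c] by simp
  have BWPa: "B\<^sup>T *\<^sub>v (W *\<^sub>v (P *\<^sub>v a)) = 0\<^sub>v d"
    using congruence_scalar_prod(1)[OF B P W c a] BWP zero[OF a] by simp
  have BWB: "B\<^sup>T *\<^sub>v (W *\<^sub>v (B *\<^sub>v c)) = (B\<^sup>T * W * B) *\<^sub>v c"
    using congruence_scalar_prod(1)[OF B B W c c] by simp
  have ac: "a @\<^sub>v c \<in> carrier_vec (r + d)" using a c by auto
  have "(?U\<^sup>T * W * ?U) *\<^sub>v (a @\<^sub>v c) = ?U\<^sup>T *\<^sub>v (W *\<^sub>v (?U *\<^sub>v (a @\<^sub>v c)))"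
    by (rule congruence_scalar_prod(1)[OF U U W ac ac])
  also have "W *\<^sub>v (?U *\<^sub>v (a @\<^sub>v c)) = W *\<^sub>v (P *\<^sub>v a) + W *\<^sub>v (B *\<^sub>v c)"
    unfolding hcat_mult_vec[OF P B a c] by (rule mult_add_distrib_mat_vec[OF W Pa Bc])
  also have "?U\<^sup>T *\<^sub>v \<dots> = (P\<^sup>T *\<^sub>v (W *\<^sub>v (P *\<^sub>v a) + W *\<^sub>v (B *\<^sub>v c))) @\<^sub>v (B\<^sup>T *\<^sub>v (W *\<^sub>v (P *\<^sub>v a) + W *\<^sub>v (B *\<^sub>v c)))"
    using WPa WBc by (intro hcat_transpose_mult_vec[OF P B]) auto
  also have "P\<^sup>T *\<^sub>v (W *\<^sub>v (P *\<^sub>v a) + W *\<^sub>v (B *\<^sub>v c)) = 0\<^sub>v r"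
    unfolding mult_add_distrib_mat_vec[OF PT WPa WBc] PWP PWB by simp
  also have "B\<^sup>T *\<^sub>v (W *\<^sub>v (P *\<^sub>v a) + W *\<^sub>v (B *\<^sub>v c)) = (B\<^sup>T * W * B) *\<^sub>v c"
    unfolding mult_add_distrib_mat_vec[OF BT WPa WBc] BWPa BWB
    using congruence_symmetric(1)[OF B] c by (intro left_zero_vec) auto
  finally show ?thesis .
qed

lemma psd_block:
  assumes B: "B \<in> carrier_mat n d" and psd: "psd ((hcat P B)\<^sup>T * W * hcat P B)"
    and 0: "P\<^sup>T * W * B = 0\<^sub>m r d"
  shows "psd (B\<^sup>T * W * B)"
proof -
  note BWB = congruence_symmetric[OF B]
  note UWU = congruence_symmetric[OF hcat_carrier[OF P B]]
  have "0 \<le> c \<bullet> ((B\<^sup>T * W * B) *\<^sub>v c)" if c: "c \<in> carrier_vec d" for c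
  proof -
    have "0 \<le> (0\<^sub>v r @\<^sub>v c) \<bullet> (((hcat P B)\<^sup>T * W * hcat P B) *\<^sub>v (0\<^sub>v r @\<^sub>v c))"
      using c by (intro psdD(2)[OF psd UWU(1)]) auto
    also have "\<dots> = 0\<^sub>v r \<bullet> 0\<^sub>v r + c \<bullet> ((B\<^sup>T * W * B) *\<^sub>v c)"
      unfolding hcat_congruence_mult_vec[OF B 0 zero_carrier_vec c]
      using BWB c by (intro scalar_prod_append[of _ r _ d]) auto
    finally show ?thesis by simp
  qed
  thus ?thesis using BWB by (auto simp: psd_def)
qed

text \<open>The kernel of diag(0, \<open>B\<^sup>T * W * B\<close>) is spanned by the columns of
  diag(I, X), which are independent. The rank is therefore \<open>(r + d) - (r + d')\<close>, the
  number of columns lost in passing from \<open>B\<close> to \<open>B * X\<close>.\<close>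

lemma rank_block:
  assumes B: "B \<in> carrier_mat n d" and 0: "P\<^sup>T * W * B = 0\<^sub>m r d"
    and X: "X \<in> carrier_mat d d'" "full_column_rank X" "column_space X = mat_kernel (B\<^sup>T * W * B)"
  shows "mat_rank ((hcat P B)\<^sup>T * W * hcat P B) + d' = d"
proof -
  let ?U = "hcat P B" and ?D = "four_block_mat (1\<^sub>m r) (0\<^sub>m r d') (0\<^sub>m d r) X"
  have UWU: "?U\<^sup>T * W * ?U \<in> carrier_mat (r + d) (r + d)" and BWB: "B\<^sup>T * W * B \<in> carrier_mat d d"
    using congruence_symmetric[OF hcat_carrier[OF P B]] congruence_symmetric[OF B] by auto
  have D: "?D \<in> carrier_mat (r + d) (r + d')" using X by (intro four_block_carrier_mat) auto
  have D_mult: "?D *\<^sub>v (a @\<^sub>v c) = a @\<^sub>v X *\<^sub>v c" if "a \<in> carrier_vec r" "c \<in> carrier_vec d'" for a c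
  proof -
    have "0\<^sub>m r d' *\<^sub>v c = 0\<^sub>v r" "0\<^sub>m d r *\<^sub>v a = 0\<^sub>v d" using that by auto
    thus ?thesis using that X by (subst four_block_mat_mult_vec[OF _ _ _ X(1) that]) auto
  qed
  have zero: "0\<^sub>v (r + k) = 0\<^sub>v r @\<^sub>v (0\<^sub>v k :: real vec)" for k by (intro eq_vecI) auto
  have "full_column_rank ?D"
    unfolding full_column_rank_iff[OF D]
  proof (intro ballI impI)
    fix z assume z: "z \<in> carrier_vec (r + d')" "?D *\<^sub>v z = 0\<^sub>v (r + d)"
    obtain a c where ac: "a \<in> carrier_vec r" "c \<in> carrier_vec d'" "z = a @\<^sub>v c"
      using carrier_vec_append_cases[OF z(1)] .
    have "a = 0\<^sub>v r \<and> X *\<^sub>v c = 0\<^sub>v d"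
      using z(2) unfolding ac(3) D_mult[OF ac(1,2)] zero by (subst (asm) append_vec_eq[of _ r]) (use ac in auto)
    thus "z = 0\<^sub>v (r + d')" using full_column_rankD[OF X(2,1) ac(2)] ac(3) zero by simp
  qed
  hence rank_D: "mat_rank ?D = r + d'" unfolding full_column_rank_def carrier_matD(2)[OF D] .
  have kernel: "(a @\<^sub>v c \<in> mat_kernel (?U\<^sup>T * W * ?U)) \<longleftrightarrow> c \<in> mat_kernel (B\<^sup>T * W * B)"
    if "a \<in> carrier_vec r" "c \<in> carrier_vec d" for a c
    using that unfolding mat_kernel[OF UWU] mat_kernel[OF BWB]
    by (simp add: hcat_congruence_mult_vec[OF B 0 that] zero append_vec_eq[of _ r])
  have "column_space ?D = mat_kernel (?U\<^sup>T * W * ?U)"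
    unfolding column_space_eq[OF D]
  proof (intro equalityI subsetI)
    fix z assume "z \<in> (*\<^sub>v) ?D ` carrier_vec (r + d')"
    then obtain v where v: "v \<in> carrier_vec (r + d')" "z = ?D *\<^sub>v v" by auto
    obtain a c where ac: "a \<in> carrier_vec r" "c \<in> carrier_vec d'" "v = a @\<^sub>v c"
      using carrier_vec_append_cases[OF v(1)] .
    have "X *\<^sub>v c \<in> mat_kernel (B\<^sup>T * W * B)"
      using X(3) ac(2) unfolding column_space_eq[OF X(1)] by auto
    thus "z \<in> mat_kernel (?U\<^sup>T * W * ?U)"
      unfolding v(2) ac(3) D_mult[OF ac(1,2)] using kernel[OF ac(1), of "X *\<^sub>v c"] X(1) ac(2) by auto
  next
    fix z assume z: "z \<in> mat_kernel (?U\<^sup>T * W * ?U)"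
    hence "z \<in> carrier_vec (r + d)" using mat_kernel_carrier[OF UWU] by auto
    then obtain a c where ac: "a \<in> carrier_vec r" "c \<in> carrier_vec d" "z = a @\<^sub>v c"
      by (rule carrier_vec_append_cases)
    have "c \<in> column_space X" unfolding X(3) using z kernel[OF ac(1,2)] ac(3) by simp
    then obtain c' where c': "c' \<in> carrier_vec d'" "c = X *\<^sub>v c'" unfolding column_space_eq[OF X(1)] by auto
    have "z = ?D *\<^sub>v (a @\<^sub>v c')" unfolding D_mult[OF ac(1) c'(1)] ac(3) c'(2) ..
    thus "z \<in> (*\<^sub>v) ?D ` carrier_vec (r + d')" using ac(1) c'(1) by auto
  qed
  from rank_add_rank_kernel[OF UWU D this] rank_D show ?thesis by simp
qed

lemma psd_W_T:
  assumes "psd W" "a \<in> carrier_vec (r + 1)"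
  shows "W *\<^sub>v (T *\<^sub>v a) = 0\<^sub>v n"
proof (rule psd_isotropic_imp_kernel[OF W assms(1)])
  show Ta: "T *\<^sub>v a \<in> carrier_vec n" using T assms by auto
  hence "W *\<^sub>v (T *\<^sub>v a) \<in> carrier_vec n" using W by auto
  thus "(T *\<^sub>v a) \<bullet> (W *\<^sub>v (T *\<^sub>v a)) = 0"
    using transpose_scalar_prod(2)[OF T _ assms(2), of "W *\<^sub>v (T *\<^sub>v a)"] T_W_T_mult_vec[OF assms(2)] assms(2) by simp
qed

text \<open>A semidefinite stress annihilates T, whose vectors are isotropic for it. So in the
  orthogonal decomposition of a kernel vector the component orthogonal to T lies in the kernel
  too.\<close>

lemma psd_kernel_decompose:
  assumes psd: "psd W" and full: "full_column_rank T"
    and R: "R \<in> carrier_mat n d" "column_space R = mat_kernel (W @\<^sub>r P\<^sup>T @\<^sub>r mat_of_row (ones_vec n))"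
  shows "mat_kernel W = {T *\<^sub>v a + R *\<^sub>v c | a c. a \<in> carrier_vec (r + 1) \<and> c \<in> carrier_vec d}"
proof (intro equalityI subsetI)
  fix x assume "x \<in> mat_kernel W"
  hence x: "x \<in> carrier_vec n" "W *\<^sub>v x = 0\<^sub>v n" using mat_kernelD[OF W] by auto
  obtain a y where ay: "a \<in> carrier_vec (r + 1)" "y \<in> carrier_vec n" "x = T *\<^sub>v a + y" "T\<^sup>T *\<^sub>v y = 0\<^sub>v (r + 1)"
    using orthogonal_decomposition[OF T full x(1)] .
  have "W *\<^sub>v x = W *\<^sub>v (T *\<^sub>v a) + W *\<^sub>v y"
    unfolding ay(3) using T ay by (intro mult_add_distrib_mat_vec[OF W]) auto
  hence "W *\<^sub>v y = 0\<^sub>v n" using x(2) psd_W_T[OF psd ay(1)] W ay(2) by simp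
  hence "y \<in> column_space R" unfolding R(2) stacked_kernel_eq[OF W P] using ay by auto
  then obtain c where "c \<in> carrier_vec d" "y = R *\<^sub>v c" unfolding column_space_eq[OF R(1)] by auto
  thus "x \<in> {T *\<^sub>v a + R *\<^sub>v c | a c. a \<in> carrier_vec (r + 1) \<and> c \<in> carrier_vec d}" using ay by blast
next
  fix x assume "x \<in> {T *\<^sub>v a + R *\<^sub>v c | a c. a \<in> carrier_vec (r + 1) \<and> c \<in> carrier_vec d}"
  then obtain a c where ac: "a \<in> carrier_vec (r + 1)" "c \<in> carrier_vec d" "x = T *\<^sub>v a + R *\<^sub>v c" by blast
  have "R *\<^sub>v c \<in> column_space R" unfolding column_space_eq[OF R(1)] using ac by auto
  hence Rc: "R *\<^sub>v c \<in> carrier_vec n" "W *\<^sub>v (R *\<^sub>v c) = 0\<^sub>v n"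
    unfolding R(2) stacked_kernel_eq[OF W P] by auto
  have Ta: "T *\<^sub>v a \<in> carrier_vec n" using T ac by auto
  have "W *\<^sub>v x = 0\<^sub>v n"
    unfolding ac(3) mult_add_distrib_mat_vec[OF W Ta Rc(1)] Rc(2) psd_W_T[OF psd ac(1)] by simp
  thus "x \<in> mat_kernel W" using Ta Rc ac(3) by (intro mat_kernelI[OF W]) auto
qed

text \<open>The kernel of \<open>W\<close> has the independent columns of \<open>hcat T R\<close> as
  a basis, hence dimension \<open>r + 1 + d\<close>. This is the count for the initial stress, as
  \<open>rank_block\<close> is for the later ones.\<close>

lemma psd_rank:
  assumes psd: "psd W" and full: "full_column_rank T"
    and R: "R \<in> carrier_mat n d" "full_column_rank R"
      "column_space R = mat_kernel (W @\<^sub>r P\<^sup>T @\<^sub>r mat_of_row (ones_vec n))"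
  shows "mat_rank W + (r + 1) + d = n"
proof -
  have H: "hcat T R \<in> carrier_mat n (r + 1 + d)" using hcat_carrier[OF T R(1)] .
  have "T\<^sup>T *\<^sub>v (R *\<^sub>v c) = 0\<^sub>v (r + 1)" if "c \<in> carrier_vec d" for c
  proof -
    have "R *\<^sub>v c \<in> column_space R" unfolding column_space_eq[OF R(1)] using that by auto
    thus ?thesis unfolding R(3) stacked_kernel_eq[OF W P] by auto
  qed
  hence "full_column_rank (hcat T R)" by (rule hcat_full_column_rank[OF T R(1) full R(2)])
  hence "mat_rank (hcat T R) = r + 1 + d" unfolding full_column_rank_def using H by simp
  moreover have "column_space (hcat T R) = mat_kernel W"
    unfolding column_space_eq[OF H] psd_kernel_decompose[OF psd full R(1,3)]
  proof (intro equalityI subsetI)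
    fix x assume "x \<in> (*\<^sub>v) (hcat T R) ` carrier_vec (r + 1 + d)"
    then obtain z where z: "z \<in> carrier_vec (r + 1 + d)" "x = hcat T R *\<^sub>v z" by auto
    obtain a c where "a \<in> carrier_vec (r + 1)" "c \<in> carrier_vec d" "z = a @\<^sub>v c"
      using carrier_vec_append_cases[OF z(1)] .
    thus "x \<in> {T *\<^sub>v a + R *\<^sub>v c | a c. a \<in> carrier_vec (r + 1) \<and> c \<in> carrier_vec d}"
      using hcat_mult_vec[OF T R(1)] z(2) by blast
  next
    fix x assume "x \<in> {T *\<^sub>v a + R *\<^sub>v c | a c. a \<in> carrier_vec (r + 1) \<and> c \<in> carrier_vec d}"
    then obtain a c where ac: "a \<in> carrier_vec (r + 1)" "c \<in> carrier_vec d" "x = T *\<^sub>v a + R *\<^sub>v c" by blast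
    have "x = hcat T R *\<^sub>v (a @\<^sub>v c)" unfolding hcat_mult_vec[OF T R(1) ac(1,2)] ac(3) ..
    thus "x \<in> (*\<^sub>v) (hcat T R) ` carrier_vec (r + 1 + d)" using ac by (metis append_carrier_vec imageI)
  qed
  ultimately show ?thesis using rank_add_rank_kernel[OF W H] by simp
qed

text \<open>Zero row and column sums cancel the pure squares in the expansion of the differences.
  Every unordered pair is counted twice, hence the factor 1/2.\<close>

lemma scalar_prod_as_differences:
  assumes x: "x \<in> carrier_vec n"
  shows "x \<bullet> (W *\<^sub>v x) = - (\<Sum>a<n. \<Sum>b<n. W $$ (a, b) * (x $ a - x $ b)\<^sup>2) / 2"
proof -
  have row0: "(\<Sum>b<n. W $$ (a, b)) = 0" if "a < n" for a
  proof -
    have "(W *\<^sub>v ones_vec n) $ a = (\<Sum>b<n. W $$ (a, b))"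
      using W that by (simp add: scalar_prod_def lessThan_atLeast0)
    thus ?thesis using W_ones that by simp
  qed
  have sym: "W $$ (a, b) = W $$ (b, a)" if "a < n" "b < n" for a b
    using W W_sym that by (metis carrier_matD index_transpose_mat(1))
  have left: "(\<Sum>a<n. \<Sum>b<n. W $$ (a, b) * (x $ a)\<^sup>2) = 0"
    using row0 by (simp add: sum_distrib_right[symmetric])
  have right: "(\<Sum>a<n. \<Sum>b<n. W $$ (a, b) * (x $ b)\<^sup>2) = 0"
  proof -
    have "(\<Sum>a<n. \<Sum>b<n. W $$ (a, b) * (x $ b)\<^sup>2) = (\<Sum>b<n. \<Sum>a<n. W $$ (b, a) * (x $ b)\<^sup>2)"
      by (subst sum.swap) (use sym in auto)
    thus ?thesis using left by simp
  qed
  have "(\<Sum>a<n. \<Sum>b<n. W $$ (a, b) * (x $ a - x $ b)\<^sup>2)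
    = (\<Sum>a<n. \<Sum>b<n. W $$ (a, b) * (x $ a)\<^sup>2) + (\<Sum>a<n. \<Sum>b<n. W $$ (a, b) * (x $ b)\<^sup>2)
      - 2 * (\<Sum>a<n. \<Sum>b<n. x $ a * W $$ (a, b) * x $ b)"
    by (simp add: power2_diff sum.distrib sum_subtractf sum_distrib_left algebra_simps)
  thus ?thesis unfolding left right scalar_prod_mult_mat_vec[OF W x x] by simp
qed

end

lemma quasi_stress_imp_configuration_stress:
  assumes "quasi_stress_matrix n r G p W"
  shows "configuration_stress n r (configuration_matrix n r p) W"
  using assms unfolding quasi_stress_matrix_def configuration_stress_def by simp

definition coordinate_vec :: "nat \<Rightarrow> (nat \<Rightarrow> real vec) \<Rightarrow> nat \<Rightarrow> real vec" where
  "coordinate_vec n q k = vec n (\<lambda>i. q i $ k)"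

text \<open>Summed over the coordinates, the energy is a weighted sum of squared distances in which
  only edges carry weight off the diagonal. So it agrees for \<open>p\<close> and \<open>q\<close>,
  and for \<open>p\<close> it is the trace of \<open>P\<^sup>T * W * P\<close>.\<close>

lemma quasi_stress_energy_eq_0:
  assumes stress: "quasi_stress_matrix n r G p W"
    and p: "\<And>i. i < n \<Longrightarrow> p i \<in> carrier_vec r" and q: "\<And>i. i < n \<Longrightarrow> q i \<in> carrier_vec s"
    and equiv: "equivalent_configurations G p q"
  shows "(\<Sum>k<s. coordinate_vec n q k \<bullet> (W *\<^sub>v coordinate_vec n q k)) = 0"
proof -
  let ?P = "configuration_matrix n r p"
  interpret configuration_stress n r ?P W using quasi_stress_imp_configuration_stress[OF stress] .
  have energy: "(\<Sum>k<m. coordinate_vec n u k \<bullet> (W *\<^sub>v coordinate_vec n u k))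
    = - (\<Sum>a<n. \<Sum>b<n. W $$ (a, b) * sq_dist (u a) (u b)) / 2"
    if u: "\<And>i. i < n \<Longrightarrow> u i \<in> carrier_vec m" for u m
  proof -
    have "(\<Sum>k<m. coordinate_vec n u k \<bullet> (W *\<^sub>v coordinate_vec n u k))
      = (\<Sum>k<m. - (\<Sum>a<n. \<Sum>b<n. W $$ (a, b) * (u a $ k - u b $ k)\<^sup>2) / 2)"
      by (intro sum.cong refl, subst scalar_prod_as_differences) (auto simp: coordinate_vec_def)
    also have "\<dots> = - (\<Sum>k<m. \<Sum>a<n. \<Sum>b<n. W $$ (a, b) * (u a $ k - u b $ k)\<^sup>2) / 2"
      by (simp add: sum_divide_distrib sum_negf)
    also have "(\<Sum>k<m. \<Sum>a<n. \<Sum>b<n. W $$ (a, b) * (u a $ k - u b $ k)\<^sup>2)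
      = (\<Sum>a<n. \<Sum>k<m. \<Sum>b<n. W $$ (a, b) * (u a $ k - u b $ k)\<^sup>2)" by (rule sum.swap)
    also have "\<dots> = (\<Sum>a<n. \<Sum>b<n. \<Sum>k<m. W $$ (a, b) * (u a $ k - u b $ k)\<^sup>2)"
      by (intro sum.cong refl sum.swap)
    also have "\<dots> = (\<Sum>a<n. \<Sum>b<n. W $$ (a, b) * sq_dist (u a) (u b))"
      using u by (intro sum.cong refl) (simp add: sq_dist_eq[of _ m] sum_distrib_left)
    finally show ?thesis .
  qed
  \<comment> \<open>Three kinds of pairs: on the diagonal the distances vanish, on edges they agree,
    and elsewhere the stress vanishes.\<close>
  have "W $$ (a, b) * sq_dist (q a) (q b) = W $$ (a, b) * sq_dist (p a) (p b)" if ab: "a < n" "b < n" for a b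
  proof (cases "a = b")
    case True
    have "sq_dist (p b) (p b) = 0" using sq_dist_eq[OF p p, of b b] ab by simp
    moreover have "sq_dist (q b) (q b) = 0" using sq_dist_eq[OF q q, of b b] ab by simp
    ultimately show ?thesis using True by simp
  next
    case False
    show ?thesis
    proof (cases "(a, b) \<in> parcs G")
      case True
      hence "sq_dist (q a) (q b) = sq_dist (p a) (p b)"
        using equiv unfolding equivalent_configurations_def by blast
      thus ?thesis by simp
    next
      case no_arc: False
      hence "W $$ (a, b) = 0" using stress ab False by (simp add: quasi_stress_matrix_def)
      thus ?thesis by simp
    qed
  qed
  hence "(\<Sum>a<n. \<Sum>b<n. W $$ (a, b) * sq_dist (q a) (q b)) = (\<Sum>a<n. \<Sum>b<n. W $$ (a, b) * sq_dist (p a) (p b))"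
    by (intro sum.cong refl) auto
  hence "(\<Sum>k<s. coordinate_vec n q k \<bullet> (W *\<^sub>v coordinate_vec n q k))
    = (\<Sum>k<r. coordinate_vec n p k \<bullet> (W *\<^sub>v coordinate_vec n p k))"
    using energy[of p r] energy[of q s] p q by simp
  also have "\<dots> = (\<Sum>k<r. 0)"
  proof (intro sum.cong refl)
    fix k assume "k \<in> {..<r}"
    hence k: "k < r" by simp
    have "?P *\<^sub>v unit_vec r k = coordinate_vec n p k"
      using k carrier_matD[OF configuration_matrix_carrier[of n r p]]
      by (intro eq_vecI) (auto simp: coordinate_vec_def configuration_matrix_index)
    hence "coordinate_vec n p k \<bullet> (W *\<^sub>v coordinate_vec n p k) = unit_vec r k \<bullet> (0\<^sub>m r r *\<^sub>v unit_vec r k)"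
      using congruence_scalar_prod(2)[OF P P W unit_vec_carrier unit_vec_carrier, of k k] P_W_P by simp
    also have "0\<^sub>m r r *\<^sub>v unit_vec r k = (0\<^sub>v r :: real vec)" by (intro eq_vecI) auto
    finally show "coordinate_vec n p k \<bullet> (W *\<^sub>v coordinate_vec n p k) = 0" by simp
  qed
  finally show ?thesis by simp
qed

section \<open>A chain of stresses forces dimensional rigidity\<close>

text \<open>The space to which the coordinate vectors of an equivalent configuration are confined;
  it shrinks to T as \<open>B\<close> loses its columns.\<close>

definition motion_space :: "real mat \<Rightarrow> real mat \<Rightarrow> real vec set" where
  "motion_space P B = {affine_matrix P *\<^sub>v a + B *\<^sub>v c | a c.
     a \<in> carrier_vec (dim_col P + 1) \<and> c \<in> carrier_vec (dim_col B)}"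

lemma sum_nonneg_eq_0D:
  fixes f :: "nat \<Rightarrow> real"
  assumes "(\<Sum>j<s. f j) = 0" "\<And>j. j < s \<Longrightarrow> 0 \<le> f j" "j < s"
  shows "f j = 0"
  using assms sum_nonneg_eq_0_iff[of "{..<s}" f] by auto

context configuration_stress
begin

lemma psd_motion_space:
  fixes s :: nat
  assumes psd: "psd W" and full: "full_column_rank T"
    and R: "R \<in> carrier_mat n d" "column_space R = mat_kernel (W @\<^sub>r P\<^sup>T @\<^sub>r mat_of_row (ones_vec n))"
    and x: "\<And>j. j < s \<Longrightarrow> x j \<in> carrier_vec n" and energy: "(\<Sum>j<s. x j \<bullet> (W *\<^sub>v x j)) = 0" and j: "j < s"
  shows "x j \<in> motion_space P R"
proof -
  have "x j \<bullet> (W *\<^sub>v x j) = 0"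
    by (rule sum_nonneg_eq_0D[OF energy _ j]) (use psdD(2)[OF psd W] x in auto)
  hence "x j \<in> mat_kernel W"
    using psd_isotropic_imp_kernel[OF W psd x[OF j]] x[OF j] by (intro mat_kernelI[OF W]) auto
  thus ?thesis unfolding psd_kernel_decompose[OF psd full R] motion_space_def using P R(1) by simp
qed

text \<open>Only the total energy is known to vanish. Since each summand is nonnegative on the
  current space, every coordinate vector is isotropic by itself, which puts its coefficients
  \<open>c\<close> into the kernel spanned by \<open>X\<close>.\<close>

lemma motion_space_refine:
  fixes s :: nat
  assumes B: "B \<in> carrier_mat n d" and 0: "P\<^sup>T * W * B = 0\<^sub>m r d"
    and psd: "psd ((hcat P B)\<^sup>T * W * hcat P B)"
    and X: "X \<in> carrier_mat d d'" "column_space X = mat_kernel (B\<^sup>T * W * B)"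
    and x: "\<And>j. j < s \<Longrightarrow> x j \<in> motion_space P B" and energy: "(\<Sum>j<s. x j \<bullet> (W *\<^sub>v x j)) = 0" and j: "j < s"
  shows "x j \<in> motion_space P (B * X)"
proof -
  have BWB: "B\<^sup>T * W * B \<in> carrier_mat d d" using congruence_symmetric(1)[OF B] .
  note psd_B = psd_block[OF B psd 0]
  have rep: "\<exists>a c. a \<in> carrier_vec (r + 1) \<and> c \<in> carrier_vec d \<and> x i = T *\<^sub>v a + B *\<^sub>v c" if "i < s" for i
    using x[OF that] P B unfolding motion_space_def by auto
  have nonneg: "0 \<le> x i \<bullet> (W *\<^sub>v x i)" if "i < s" for i
    using rep[OF that] quadratic_form_decompose[OF B 0] psdD(2)[OF psd_B BWB] by metis
  obtain a c where ac: "a \<in> carrier_vec (r + 1)" "c \<in> carrier_vec d" "x j = T *\<^sub>v a + B *\<^sub>v c"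
    using rep[OF j] by blast
  have "c \<bullet> ((B\<^sup>T * W * B) *\<^sub>v c) = 0"
    using sum_nonneg_eq_0D[OF energy nonneg j] quadratic_form_decompose[OF B 0 ac(1,2)] ac(3) by simp
  hence "c \<in> column_space X"
    unfolding X(2) using psd_isotropic_imp_kernel[OF BWB psd_B ac(2)] ac(2) by (intro mat_kernelI[OF BWB]) auto
  then obtain c' where c': "c' \<in> carrier_vec d'" "c = X *\<^sub>v c'" unfolding column_space_eq[OF X(1)] by auto
  have "x j = T *\<^sub>v a + (B * X) *\<^sub>v c'" unfolding ac(3) c'(2) assoc_mult_mat_vec[OF B X(1) c'(1)] ..
  thus ?thesis unfolding motion_space_def using ac(1) c'(1) P X(1) by auto
qed

end

section \<open>Dimension bound for configurations with coordinates in T\<close>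

lemma affine_matrix_mult_vec_index:
  assumes P: "P \<in> carrier_mat n r" and a: "a \<in> carrier_vec (r + 1)" and i: "i < n"
  shows "(affine_matrix P *\<^sub>v a) $ i = (\<Sum>l<r. P $$ (i, l) * a $ l) + a $ r"
proof -
  obtain a' b where ab: "a' \<in> carrier_vec r" "b \<in> carrier_vec 1" "a = a' @\<^sub>v b"
    using carrier_vec_append_cases[OF a] .
  have "(\<Sum>l<r. P $$ (i, l) * a' $ l) = (\<Sum>l<r. P $$ (i, l) * a $ l)"
    unfolding ab(3) using ab by (intro sum.cong) auto
  moreover have "b $ 0 = a $ r" unfolding ab(3) using ab by simp
  moreover have "(affine_matrix P *\<^sub>v a) $ i = (\<Sum>l<r. P $$ (i, l) * a' $ l) + b $ 0"
    unfolding ab(3) affine_matrix_mult_vec[OF P ab(1,2)]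
    using P ab(1) i by (simp add: scalar_prod_def lessThan_atLeast0)
  ultimately show ?thesis by simp
qed

text \<open>Padding with zero rows gives a square matrix. If it were injective it would be onto, but
  it cannot reach \<open>unit_vec s r\<close>, because its row \<open>r\<close> is zero.\<close>

lemma wide_matrix_kernel:
  assumes "r < s"
  obtains z where "z \<in> carrier_vec s" "z \<noteq> 0\<^sub>v s" "\<And>l. l < r \<Longrightarrow> (\<Sum>j<s. A l j * z $ j) = (0 :: real)"
proof -
  define M where "M = mat s s (\<lambda>(l, j). if l < r then A l j else 0)"
  have M: "M \<in> carrier_mat s s" by (simp add: M_def)
  have index: "(M *\<^sub>v z) $ l = (if l < r then \<Sum>j<s. A l j * z $ j else 0)" if "z \<in> carrier_vec s" "l < s" for z l
    using that by (simp add: M_def scalar_prod_def lessThan_atLeast0)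
  have "\<not> (\<forall>z\<in>carrier_vec s. M *\<^sub>v z = 0\<^sub>v s \<longrightarrow> z = 0\<^sub>v s)"
  proof
    assume "\<forall>z\<in>carrier_vec s. M *\<^sub>v z = 0\<^sub>v s \<longrightarrow> z = 0\<^sub>v s"
    then obtain z where z: "z \<in> carrier_vec s" "M *\<^sub>v z = unit_vec s r"
      using square_injective_surjective[OF M _ unit_vec_carrier[of s r]] by blast
    have "unit_vec s r $ r = (0 :: real)" using index[OF z(1) assms] z(2) by simp
    thus False using assms by simp
  qed
  then obtain z where z: "z \<in> carrier_vec s" "M *\<^sub>v z = 0\<^sub>v s" "z \<noteq> 0\<^sub>v s" by blast
  have "(\<Sum>j<s. A l j * z $ j) = 0" if "l < r" for l
    using index[OF z(1), of l] z(2) that assms by simp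
  thus ?thesis using that z by blast
qed

text \<open>Each coordinate of \<open>q\<close> is an affine function of the rows of
  \<open>P\<close>, with constant term in entry \<open>r\<close> of its coefficient vector. If
  \<open>r < s\<close>, some nonzero \<open>z\<close> cancels the \<open>r\<close> linear parts;
  then \<open>q i \<bullet> z\<close> does not depend on \<open>i\<close>, and \<open>q\<close> lies
  in a hyperplane.\<close>

lemma affine_dependent_coordinates_imp_dim_le:
  assumes P: "P \<in> carrier_mat n r" and span: "affine_span n s q = carrier_vec s"
    and q: "\<And>i. i < n \<Longrightarrow> q i \<in> carrier_vec s"
    and coord: "\<And>j. j < s \<Longrightarrow> \<exists>a\<in>carrier_vec (r + 1). coordinate_vec n q j = affine_matrix P *\<^sub>v a"
  shows "s \<le> r"
proof (rule ccontr)
  assume "\<not> s \<le> r"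
  hence s: "r < s" by simp
  obtain a where a: "\<And>j. j < s \<Longrightarrow> a j \<in> carrier_vec (r + 1)"
    "\<And>j. j < s \<Longrightarrow> coordinate_vec n q j = affine_matrix P *\<^sub>v a j"
    using coord by metis
  obtain z where z: "z \<in> carrier_vec s" "z \<noteq> 0\<^sub>v s" "\<And>l. l < r \<Longrightarrow> (\<Sum>j<s. a j $ l * z $ j) = 0"
    using wide_matrix_kernel[OF s, of "\<lambda>l j. a j $ l"] by blast
  have "q i \<bullet> z = (\<Sum>j<s. a j $ r * z $ j)" if i: "i < n" for i
  proof -
    have "q i \<bullet> z = (\<Sum>j<s. coordinate_vec n q j $ i * z $ j)"
      using z(1) i by (simp add: scalar_prod_def lessThan_atLeast0 coordinate_vec_def)
    also have "\<dots> = (\<Sum>j<s. ((\<Sum>l<r. P $$ (i, l) * a j $ l) + a j $ r) * z $ j)"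
      using a affine_matrix_mult_vec_index[OF P _ i] by (intro sum.cong) auto
    also have "\<dots> = (\<Sum>j<s. \<Sum>l<r. P $$ (i, l) * (a j $ l * z $ j)) + (\<Sum>j<s. a j $ r * z $ j)"
      by (simp add: distrib_right sum.distrib sum_distrib_right mult.assoc)
    also have "(\<Sum>j<s. \<Sum>l<r. P $$ (i, l) * (a j $ l * z $ j)) = (\<Sum>l<r. P $$ (i, l) * (\<Sum>j<s. a j $ l * z $ j))"
      by (subst sum.swap) (simp add: sum_distrib_left)
    also have "\<dots> = 0" using z(3) by simp
    finally show ?thesis by simp
  qed
  hence "z = 0\<^sub>v s"
    by (intro affinely_spanning_imp_not_in_hyperplane[OF span _ z(1)]) (use q in auto)
  thus False using z(2) by simp
qed

text \<open>The dimensions of \<open>\<rho>\<close> and \<open>\<xi>\<close> are not given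
  explicitly but have to be read off from their column spaces; the zero vector, always present
  there, reveals the number of rows.\<close>

lemma dim_row_eq_if_column_space_subset:
  assumes "column_space A \<subseteq> carrier_vec m"
  shows "A \<in> carrier_mat m (dim_col A)"
proof -
  have A: "A \<in> carrier_mat (dim_row A) (dim_col A)" by simp
  have "A *\<^sub>v 0\<^sub>v (dim_col A) \<in> carrier_vec m"
    using assms unfolding column_space_eq[OF A] by (meson imageI subsetD zero_carrier_vec)
  from carrier_vecD[OF this] have "dim_row A = m" by simp
  thus ?thesis by (intro carrier_matI) auto
qed

text \<open>The conditions on a single triple of the chain, shared by both directions of the
  equivalence; the links between consecutive triples and the rank count are stated
  separately.\<close>

definition stress_stage ::
    "nat \<Rightarrow> nat \<Rightarrow> nat pair_pre_digraph \<Rightarrow> (nat \<Rightarrow> real vec) \<Rightarrow> real mat \<Rightarrow> real mat \<Rightarrow> real mat \<Rightarrow> bool" where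
  "stress_stage n r G p W B X \<longleftrightarrow> (let P = configuration_matrix n r p; U = hcat P B in
     quasi_stress_matrix n r G p W \<and> W \<noteq> 0\<^sub>m n n \<and>
     full_column_rank B \<and> full_column_rank U \<and> full_column_rank X \<and>
     column_space X = mat_kernel (B\<^sup>T * W * B) \<and> psd (U\<^sup>T * W * U) \<and>
     P\<^sup>T * W * B = 0\<^sub>m r (dim_col B))"

lemma stress_chain_imp_dimensionally_rigid:
  fixes k :: nat and \<Omega> \<rho> \<xi> :: "nat \<Rightarrow> real mat"
  assumes fw: "dim_framework n r G p" and n: "r + 2 \<le> n" and conf: "P = configuration_matrix n r p"
    and centered: "P\<^sup>T *\<^sub>v ones_vec n = 0\<^sub>v r"
    and W0: "quasi_stress_matrix n r G p (\<Omega> 0)" "psd (\<Omega> 0)"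
    and stage: "\<And>i. i \<in> {1..k} \<Longrightarrow> stress_stage n r G p (\<Omega> i) (\<rho> i) (\<xi> i)"
    and start: "1 \<le> k \<Longrightarrow> column_space (\<rho> 1) = mat_kernel (\<Omega> 0 @\<^sub>r P\<^sup>T @\<^sub>r mat_of_row (ones_vec n))"
    and succ: "\<And>i. i \<in> {1..<k} \<Longrightarrow> \<rho> (i + 1) = \<rho> i * \<xi> i"
    and rank: "mat_rank (\<Omega> 0) + (\<Sum>i\<in>{1..k}. mat_rank ((hcat P (\<rho> i))\<^sup>T * \<Omega> i * hcat P (\<rho> i))) = n - r - 1"
  shows "dimensionally_rigid n r G p"
  unfolding dimensionally_rigid_def
proof (intro conjI notI)
  show "dim_framework n r G p" by fact
  assume "\<exists>s q. r + 1 \<le> s \<and> dim_framework n s G q \<and> equivalent_configurations G p q"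
  then obtain s q where s: "r + 1 \<le> s" and fq: "dim_framework n s G q" and eqv: "equivalent_configurations G p q" by blast
  have p: "\<And>i. i < n \<Longrightarrow> p i \<in> carrier_vec r" using fw by (auto simp: dim_framework_def bar_framework_def)
  have q: "\<And>i. i < n \<Longrightarrow> q i \<in> carrier_vec s" and span: "affine_span n s q = carrier_vec s"
    using fq by (auto simp: dim_framework_def bar_framework_def)
  have Pc: "P \<in> carrier_mat n r" by (simp add: conf)
  have full: "full_column_rank (affine_matrix P)"
    using affine_matrix_full_column_rank[OF Pc _ centered] configuration_matrix_full_column_rank[OF fw] n conf by simp
  let ?x = "coordinate_vec n q"
  have energy: "(\<Sum>j<s. ?x j \<bullet> (W *\<^sub>v ?x j)) = 0" if "quasi_stress_matrix n r G p W" for W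
    by (rule quasi_stress_energy_eq_0[OF that p q eqv])
  have x: "?x j \<in> carrier_vec n" for j by (simp add: coordinate_vec_def)
  interpret W0: configuration_stress n r P "\<Omega> 0" unfolding conf by (rule quasi_stress_imp_configuration_stress[OF W0(1)])
  have "\<exists>B. B \<in> carrier_mat n 0 \<and> (\<forall>j<s. ?x j \<in> motion_space P B)"
  proof (cases "k = 0")
    case True
    \<comment> \<open>Without later stages no \<open>\<rho>\<close> is constrained, so a basis
      \<open>R\<close> of the same kernel is chosen here; the rank condition leaves it no
      columns.\<close>
    have "\<Omega> 0 @\<^sub>r P\<^sup>T @\<^sub>r mat_of_row (ones_vec n) \<in> carrier_mat (n + (r + 1)) n"
      by (intro carrier_append_rows) (use W0.W Pc in auto)
    then obtain d R where R: "R \<in> carrier_mat n d" "full_column_rank R"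
      "column_space R = mat_kernel (\<Omega> 0 @\<^sub>r P\<^sup>T @\<^sub>r mat_of_row (ones_vec n))"
      by (rule kernel_basis_matrix)
    have "(\<Sum>i\<in>{1..k}. mat_rank ((hcat P (\<rho> i))\<^sup>T * \<Omega> i * hcat P (\<rho> i))) = 0"
      using True by (intro sum.neutral) simp
    hence "d = 0" using W0.psd_rank[OF W0(2) full R] rank n by linarith
    thus ?thesis using W0.psd_motion_space[OF W0(2) full R(1,3) x energy[OF W0(1)]] R(1) by blast
  next
    case False
    hence k: "1 \<le> k" by simp
    have quasi: "quasi_stress_matrix n r G p (\<Omega> i)" if "i \<in> {1..k}" for i
      using stage[OF that] by (simp add: stress_stage_def Let_def)
    have \<rho>1: "\<rho> 1 \<in> carrier_mat n (dim_col (\<rho> 1))"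
      using start[OF k] stacked_kernel_eq[OF W0.W Pc] by (intro dim_row_eq_if_column_space_subset) auto
    have \<rho>: "\<rho> i \<in> carrier_mat n (dim_col (\<rho> i))" if "1 \<le> i" "i \<le> k" for i
      using that
    proof (induction i rule: dec_induct)
      case base
      show ?case by (rule \<rho>1)
    next
      case (step i)
      thus ?case using succ[of i] by (intro carrier_matI) auto
    qed
    have \<xi>: "\<xi> i \<in> carrier_mat (dim_col (\<rho> i)) (dim_col (\<xi> i))" if "1 \<le> i" "i \<le> k" for i
    proof (rule dim_row_eq_if_column_space_subset)
      have "column_space (\<xi> i) = mat_kernel ((\<rho> i)\<^sup>T * \<Omega> i * \<rho> i)"
        using stage[of i] that by (simp add: stress_stage_def Let_def)
      thus "column_space (\<xi> i) \<subseteq> carrier_vec (dim_col (\<rho> i))" by (auto simp: mat_kernel_def)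
    qed
    let ?rk = "\<lambda>i. mat_rank ((hcat P (\<rho> i))\<^sup>T * \<Omega> i * hcat P (\<rho> i))"
    have rk: "?rk i + dim_col (\<xi> i) = dim_col (\<rho> i)"
      and refine: "(\<And>j. j < s \<Longrightarrow> ?x j \<in> motion_space P (\<rho> i)) \<Longrightarrow> j < s \<Longrightarrow> ?x j \<in> motion_space P (\<rho> i * \<xi> i)"
      if i: "1 \<le> i" "i \<le> k" for i j
    proof -
      interpret configuration_stress n r P "\<Omega> i" unfolding conf
        using quasi_stress_imp_configuration_stress[OF quasi] i by simp
      have st: "full_column_rank (\<xi> i)" "column_space (\<xi> i) = mat_kernel ((\<rho> i)\<^sup>T * \<Omega> i * \<rho> i)"
        "psd ((hcat P (\<rho> i))\<^sup>T * \<Omega> i * hcat P (\<rho> i))" "P\<^sup>T * \<Omega> i * \<rho> i = 0\<^sub>m r (dim_col (\<rho> i))"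
        using stage[of i] i by (auto simp: stress_stage_def Let_def conf)
      show "?rk i + dim_col (\<xi> i) = dim_col (\<rho> i)"
        by (rule rank_block[OF \<rho>[OF i] st(4) \<xi>[OF i] st(1,2)])
      show "?x j \<in> motion_space P (\<rho> i * \<xi> i)"
        if "\<And>j. j < s \<Longrightarrow> ?x j \<in> motion_space P (\<rho> i)" "j < s"
        using motion_space_refine[OF \<rho>[OF i] st(4,3) \<xi>[OF i] st(2) that(1) energy[OF quasi] that(2)] i by simp
    qed
    \<comment> \<open>The invariant uses the product \<open>\<rho> m * \<xi> m\<close> rather than
      \<open>\<rho> (m + 1)\<close>, which is not constrained for \<open>m = k\<close>. The ranks
      telescope because \<open>\<xi> m\<close> and the next \<open>\<rho>\<close> have the same
      number of columns.\<close>
    have "(\<Sum>i\<in>{1..m}. ?rk i) + dim_col (\<xi> m) = dim_col (\<rho> 1) \<and> (\<forall>j<s. ?x j \<in> motion_space P (\<rho> m * \<xi> m))"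
      if "1 \<le> m" "m \<le> k" for m
      using that
    proof (induction m rule: dec_induct)
      case base
      have "?x j \<in> motion_space P (\<rho> 1)" if "j < s" for j
        by (rule W0.psd_motion_space[OF W0(2) full \<rho>1 start[OF k] x energy[OF W0(1)] that])
      thus ?case using rk[of 1] refine[of 1] k by simp
    next
      case (step m)
      hence \<rho>_Suc: "\<rho> (Suc m) = \<rho> m * \<xi> m" using succ[of m] by simp
      hence "dim_col (\<rho> (Suc m)) = dim_col (\<xi> m)" by simp
      thus ?case using step rk[of "Suc m"] refine[of "Suc m"] \<rho>_Suc by simp
    qed
    from this[OF k order.refl] have sum: "(\<Sum>i\<in>{1..k}. ?rk i) + dim_col (\<xi> k) = dim_col (\<rho> 1)"
      and final: "\<forall>j<s. ?x j \<in> motion_space P (\<rho> k * \<xi> k)" by auto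
    have "full_column_rank (\<rho> 1)" using stage[of 1] k by (simp add: stress_stage_def Let_def)
    \<comment> \<open>\<open>psd_rank\<close> gives the number of columns of \<open>\<rho> 1\<close>
      as \<open>n - r - 1 - mat_rank (\<Omega> 0)\<close>, which by the rank condition is exactly
      what the stages remove.\<close>
    from W0.psd_rank[OF W0(2) full \<rho>1 this start[OF k]] have "dim_col (\<xi> k) = 0"
      using sum rank n by linarith
    hence "\<rho> k * \<xi> k \<in> carrier_mat n 0" using \<rho>[OF k order.refl] by (intro carrier_matI) auto
    thus ?thesis using final by blast
  qed
  then obtain B where B: "B \<in> carrier_mat n 0" "\<And>j. j < s \<Longrightarrow> ?x j \<in> motion_space P B" by blast
  have "s \<le> r"
  proof (rule affine_dependent_coordinates_imp_dim_le[OF Pc span q])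
    fix j assume j: "j < s"
    obtain a c where ac: "a \<in> carrier_vec (r + 1)" "c \<in> carrier_vec 0" "?x j = affine_matrix P *\<^sub>v a + B *\<^sub>v c"
      using B(2)[OF j] B(1) Pc unfolding motion_space_def by auto
    have "B *\<^sub>v c = 0\<^sub>v n" using B(1) ac(2) by (intro eq_vecI) (auto simp: scalar_prod_def)
    moreover have "affine_matrix P *\<^sub>v a \<in> carrier_vec n" using affine_matrix_carrier[OF Pc] ac(1) by auto
    ultimately show "\<exists>a\<in>carrier_vec (r + 1). ?x j = affine_matrix P *\<^sub>v a" using ac by auto
  qed
  thus False using s by simp
qed

section \<open>Stresses from separation\<close>

text \<open>The weighted graph Laplacian: a sum of matrices \<open>w e\<close> times u u^T, where u
  is the difference of the unit vectors at the ends of \<open>e\<close>. \<open>E\<close> holds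
  arcs, so the two orientations of an edge add their weights.\<close>

definition edge_stress :: "nat \<Rightarrow> (nat \<times> nat) set \<Rightarrow> (nat \<times> nat \<Rightarrow> real) \<Rightarrow> real mat" where
  "edge_stress n E w = mat n n (\<lambda>(a, b). \<Sum>e\<in>E. w e *
     (((if a = fst e then 1 else 0) - (if a = snd e then 1 else 0)) *
      ((if b = fst e then 1 else 0) - (if b = snd e then 1 else 0))))"

lemma edge_stress_carrier: "edge_stress n E w \<in> carrier_mat n n"
  by (simp add: edge_stress_def)

lemma edge_stress_symmetric: "(edge_stress n E w)\<^sup>T = edge_stress n E w"
  by (rule eq_matI) (auto simp: edge_stress_def mult.commute intro!: sum.cong)

lemma sum_indicator_difference:
  fixes x :: "nat \<Rightarrow> real"
  assumes "i < n" "j < n"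
  shows "(\<Sum>a<n. x a * ((if a = i then 1 else 0) - (if a = j then 1 else 0))) = x i - x j"
proof -
  have "(\<Sum>a<n. x a * ((if a = i then 1 else 0) - (if a = j then 1 else 0)))
    = (\<Sum>a<n. if a = i then x a else 0) - (\<Sum>a<n. if a = j then x a else 0)"
    unfolding sum_subtractf[symmetric] by (intro sum.cong) auto
  thus ?thesis using assms by simp
qed

lemma edge_stress_bilinear:
  assumes E: "E \<subseteq> {0..<n} \<times> {0..<n}" and x: "x \<in> carrier_vec n" and y: "y \<in> carrier_vec n"
  shows "x \<bullet> (edge_stress n E w *\<^sub>v y)
    = (\<Sum>e\<in>E. w e * ((x $ fst e - x $ snd e) * (y $ fst e - y $ snd e)))"
proof -
  let ?\<delta> = "\<lambda>a e. (if a = fst e then 1 else 0) - (if a = snd e then 1 else 0 :: real)"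
  have "x \<bullet> (edge_stress n E w *\<^sub>v y) = (\<Sum>a<n. \<Sum>b<n. x $ a * (\<Sum>e\<in>E. w e * (?\<delta> a e * ?\<delta> b e)) * y $ b)"
    unfolding scalar_prod_mult_mat_vec[OF edge_stress_carrier x y]
    by (intro sum.cong refl) (simp add: edge_stress_def)
  also have "\<dots> = (\<Sum>a<n. \<Sum>b<n. \<Sum>e\<in>E. w e * ((x $ a * ?\<delta> a e) * (y $ b * ?\<delta> b e)))"
    unfolding sum_distrib_left sum_distrib_right by (intro sum.cong refl) (simp only: mult_ac)
  also have "\<dots> = (\<Sum>a<n. \<Sum>e\<in>E. \<Sum>b<n. w e * ((x $ a * ?\<delta> a e) * (y $ b * ?\<delta> b e)))"
    by (intro sum.cong refl sum.swap)
  also have "\<dots> = (\<Sum>e\<in>E. \<Sum>a<n. \<Sum>b<n. w e * ((x $ a * ?\<delta> a e) * (y $ b * ?\<delta> b e)))"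
    by (rule sum.swap)
  also have "\<dots> = (\<Sum>e\<in>E. w e * ((\<Sum>a<n. x $ a * ?\<delta> a e) * (\<Sum>b<n. y $ b * ?\<delta> b e)))"
    unfolding sum_product by (simp only: sum_distrib_left)
  also have "\<dots> = (\<Sum>e\<in>E. w e * ((x $ fst e - x $ snd e) * (y $ fst e - y $ snd e)))"
  proof (intro sum.cong refl)
    fix e assume "e \<in> E"
    hence "fst e < n" "snd e < n" using E by auto
    thus "w e * ((\<Sum>a<n. x $ a * ?\<delta> a e) * (\<Sum>b<n. y $ b * ?\<delta> b e))
      = w e * ((x $ fst e - x $ snd e) * (y $ fst e - y $ snd e))"
      by (simp only: sum_indicator_difference)
  qed
  finally show ?thesis .
qed

lemma edge_stress_ones:
  assumes "E \<subseteq> {0..<n} \<times> {0..<n}"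
  shows "edge_stress n E w *\<^sub>v ones_vec n = 0\<^sub>v n"
proof -
  let ?y = "edge_stress n E w *\<^sub>v ones_vec n"
  have y: "?y \<in> carrier_vec n" using edge_stress_carrier by (meson mult_mat_vec_carrier vec_carrier)
  \<comment> \<open>The bilinear formula involves only differences of entries, and those of the
    all-ones vector vanish.\<close>
  have "?y \<bullet> ?y = 0"
    unfolding edge_stress_bilinear[OF assms y vec_carrier]
  proof (intro sum.neutral ballI)
    fix e assume "e \<in> E"
    hence "fst e < n" "snd e < n" using assms by auto
    thus "w e * ((?y $ fst e - ?y $ snd e) * (ones_vec n $ fst e - ones_vec n $ snd e)) = 0" by simp
  qed
  thus ?thesis using scalar_prod_self_eq_0[OF y] by simp
qed

lemma edge_stress_congruence_index:
  assumes E: "E \<subseteq> {0..<n} \<times> {0..<n}" and A: "A \<in> carrier_mat n d" and B: "B \<in> carrier_mat n d'"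
    and ij: "i < d" "j < d'"
  shows "(A\<^sup>T * edge_stress n E w * B) $$ (i, j) = (\<Sum>e\<in>E. w e *
    ((A $$ (fst e, i) - A $$ (snd e, i)) * (B $$ (fst e, j) - B $$ (snd e, j))))"
proof -
  let ?W = "edge_stress n E w"
  have M: "A\<^sup>T * ?W * B \<in> carrier_mat d d'" using A B edge_stress_carrier[of n E w] by auto
  have unit: "C *\<^sub>v unit_vec k l = col C l" if "C \<in> carrier_mat m k" "l < k" for C :: "real mat" and m k l
    using that by (intro eq_vecI) auto
  have "(A\<^sup>T * ?W * B) $$ (i, j) = unit_vec d i \<bullet> ((A\<^sup>T * ?W * B) *\<^sub>v unit_vec d' j)"
  proof -
    have "col (A\<^sup>T * ?W * B) j \<in> carrier_vec d" by (rule col_carrier_vec[OF _ M]) (rule ij(2))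
    thus ?thesis unfolding unit[OF M ij(2)] by (simp only: scalar_prod_left_unit[OF _ ij(1)] index_col carrier_matD[OF M] ij)
  qed
  also have "\<dots> = (A *\<^sub>v unit_vec d i) \<bullet> (?W *\<^sub>v (B *\<^sub>v unit_vec d' j))"
    by (rule congruence_scalar_prod(2)[OF A B edge_stress_carrier unit_vec_carrier unit_vec_carrier])
  also have "\<dots> = (\<Sum>e\<in>E. w e * ((col A i $ fst e - col A i $ snd e) * (col B j $ fst e - col B j $ snd e)))"
    unfolding unit[OF A ij(1)] unit[OF B ij(2)] using A B ij
    by (intro edge_stress_bilinear[OF E]) auto
  also have "\<dots> = (\<Sum>e\<in>E. w e * ((A $$ (fst e, i) - A $$ (snd e, i)) * (B $$ (fst e, j) - B $$ (snd e, j))))"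
  proof (intro sum.cong refl)
    fix e assume "e \<in> E"
    hence "fst e < n" "snd e < n" using E by auto
    thus "w e * ((col A i $ fst e - col A i $ snd e) * (col B j $ fst e - col B j $ snd e))
      = w e * ((A $$ (fst e, i) - A $$ (snd e, i)) * (B $$ (fst e, j) - B $$ (snd e, j)))"
      using A B ij by simp
  qed
  finally show ?thesis .
qed

section \<open>Equivalent frameworks from positive definite Gram matrices\<close>

lemma affinely_spanning_rows:
  assumes Q: "Q \<in> carrier_mat n m" and full: "full_column_rank Q"
    and centered: "Q\<^sup>T *\<^sub>v ones_vec n = 0\<^sub>v m" and n: "0 < n"
    and q: "\<And>i j. i < n \<Longrightarrow> j < m \<Longrightarrow> q i $ j = Q $$ (i, j)"
  shows "affine_span n m q = carrier_vec m"
proof (intro equalityI subsetI)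
  fix y assume y: "y \<in> (carrier_vec m :: real vec set)"
  obtain z where z: "z \<in> carrier_vec m" "Q\<^sup>T *\<^sub>v (Q *\<^sub>v z) = y" using gram_surjective[OF Q full y] .
  define v where "v = Q *\<^sub>v z"
  have v: "v \<in> carrier_vec n" using Q z by (simp add: v_def)
  \<comment> \<open>The entries of \<open>v\<close> sum to 0 by centering and represent
    \<open>y\<close>. Adding \<open>1 / real n\<close> makes the coefficients sum to 1 and leaves
    the represented point unchanged, as the rows of \<open>Q\<close> sum to 0.\<close>
  define c where "c i = v $ i + 1 / real n" for i
  have "ones_vec n \<bullet> v = (Q\<^sup>T *\<^sub>v ones_vec n) \<bullet> z"
    unfolding v_def using transpose_scalar_prod(1)[OF Q _ z(1), of "ones_vec n"] by simp
  also have "\<dots> = 0" using centered z by simp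
  also have "ones_vec n \<bullet> v = (\<Sum>i<n. v $ i)" using v by (simp add: scalar_prod_def lessThan_atLeast0)
  finally have "(\<Sum>i<n. c i) = 1" using n by (simp add: c_def sum.distrib)
  moreover have "y = vec m (\<lambda>j. \<Sum>i<n. c i * q i $ j)"
  proof (intro eq_vecI)
    fix j assume "j < dim_vec (vec m (\<lambda>j. \<Sum>i<n. c i * q i $ j))"
    hence j: "j < m" by simp
    have "(Q\<^sup>T *\<^sub>v ones_vec n) $ j = (\<Sum>i<n. Q $$ (i, j))"
      using Q j by (simp add: scalar_prod_def lessThan_atLeast0)
    hence 0: "(\<Sum>i<n. Q $$ (i, j)) = 0" using centered j by simp
    have "(\<Sum>i<n. c i * q i $ j) = (\<Sum>i<n. Q $$ (i, j) * v $ i) + (\<Sum>i<n. Q $$ (i, j)) / n"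
      unfolding sum_divide_distrib sum.distrib[symmetric] using q j
      by (intro sum.cong) (auto simp: c_def algebra_simps)
    also have "\<dots> = (Q\<^sup>T *\<^sub>v v) $ j" unfolding 0 using Q v j by (simp add: scalar_prod_def lessThan_atLeast0)
    finally show "y $ j = vec m (\<lambda>j. \<Sum>i<n. c i * q i $ j) $ j" using z(2) j by (simp add: v_def)
  qed (use y in auto)
  ultimately show "y \<in> affine_span n m q" unfolding affine_span_def by blast
qed (auto simp: affine_span_def)

lemma pos_def_factor:
  assumes Y: "pos_def m Y"
  obtains M where "M \<in> carrier_mat m m" "full_column_rank M"
    "\<And>x. x \<in> carrier_vec m \<Longrightarrow> qform m Y (($) x) = (M\<^sup>T *\<^sub>v x) \<bullet> (M\<^sup>T *\<^sub>v x)"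
proof -
  obtain L where L: "\<And>i j. i < m \<Longrightarrow> j < m \<Longrightarrow> Y i j = (\<Sum>k<m. L i k * L j k)" using cholesky[OF Y] by blast
  define M where "M = mat m m (\<lambda>(i, k). L i k)"
  have M: "M \<in> carrier_mat m m" and MT: "M\<^sup>T \<in> carrier_mat m m" by (auto simp: M_def)
  have qf: "qform m Y (($) x) = (M\<^sup>T *\<^sub>v x) \<bullet> (M\<^sup>T *\<^sub>v x)" if x: "x \<in> carrier_vec m" for x
  proof -
    have "(M\<^sup>T *\<^sub>v x) \<bullet> (M\<^sup>T *\<^sub>v x) = (\<Sum>k<m. (\<Sum>i<m. L i k * x $ i) * (\<Sum>j<m. L j k * x $ j))"
      using x by (simp add: scalar_prod_def lessThan_atLeast0 M_def)
    also have "\<dots> = (\<Sum>k<m. \<Sum>i<m. \<Sum>j<m. x $ i * (L i k * L j k) * x $ j)"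
      unfolding sum_product by (intro sum.cong refl) (simp only: mult_ac)
    also have "\<dots> = (\<Sum>i<m. \<Sum>k<m. \<Sum>j<m. x $ i * (L i k * L j k) * x $ j)" by (rule sum.swap)
    also have "\<dots> = (\<Sum>i<m. \<Sum>j<m. \<Sum>k<m. x $ i * (L i k * L j k) * x $ j)"
      by (intro sum.cong refl sum.swap)
    also have "\<dots> = qform m Y (($) x)"
      unfolding qform_def by (intro sum.cong refl) (simp add: L sum_distrib_left sum_distrib_right)
    finally show ?thesis ..
  qed
  have inj: "x = 0\<^sub>v m" if x: "x \<in> carrier_vec m" "M\<^sup>T *\<^sub>v x = 0\<^sub>v m" for x
  proof (rule ccontr)
    assume "x \<noteq> 0\<^sub>v m"
    hence "\<exists>i<m. x $ i \<noteq> 0" using x(1) by (metis carrier_vecD eq_vecI index_zero_vec)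
    hence "0 < qform m Y (($) x)" using Y by (simp add: pos_def_def)
    thus False using qf[OF x(1)] x(2) by simp
  qed
  \<comment> \<open>Definiteness gives injectivity of the transpose; since that is square,
    \<open>x\<close> lies in its range, and being orthogonal to this range \<open>x\<close>
    vanishes.\<close>
  have "x = 0\<^sub>v m" if x: "x \<in> carrier_vec m" "M *\<^sub>v x = 0\<^sub>v m" for x
  proof -
    obtain y where y: "y \<in> carrier_vec m" "M\<^sup>T *\<^sub>v y = x" using square_injective_surjective[OF MT inj x(1)] by blast
    have "x \<bullet> x = (M *\<^sub>v x) \<bullet> y" using transpose_scalar_prod(2)[OF M y(1) x(1)] y(2) by simp
    thus ?thesis using x y by (intro scalar_prod_self_eq_0) auto
  qed
  hence "full_column_rank M" using full_column_rank_iff[OF M] by blast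
  thus ?thesis using that M qf by blast
qed

text \<open>If all lengths matched, the rows of \<open>U * M\<close>, with \<open>M\<close> a factor
  of \<open>Y\<close>, would be an equivalent configuration. Definiteness makes \<open>M\<close>
  nonsingular, so \<open>U * M\<close> has independent columns orthogonal to the all-ones vector and
  its rows affinely span dimension \<open>m\<close>, more than \<open>r\<close>.\<close>

lemma rigid_imp_no_pos_def_gram:
  assumes rigid: "dimensionally_rigid n r G p" and n: "0 < n" and m: "r < m"
    and U: "U \<in> carrier_mat n m" "full_column_rank U" "U\<^sup>T *\<^sub>v ones_vec n = 0\<^sub>v m" and Y: "pos_def m Y"
  shows "\<exists>e\<in>parcs G. qform m Y (\<lambda>k. U $$ (fst e, k) - U $$ (snd e, k)) \<noteq> sq_dist (p (fst e)) (p (snd e))"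
proof (rule ccontr)
  assume "\<not> ?thesis"
  hence eq: "\<And>e. e \<in> parcs G \<Longrightarrow>
      qform m Y (\<lambda>k. U $$ (fst e, k) - U $$ (snd e, k)) = sq_dist (p (fst e)) (p (snd e))" by blast
  have fw: "bar_framework n r G p" using rigid by (simp add: dimensionally_rigid_def dim_framework_def)
  interpret G: pair_graph G using fw by (simp add: bar_framework_def)
  have verts: "pverts G = {0..<n}" using fw by (simp add: bar_framework_def)
  obtain M where M: "M \<in> carrier_mat m m" "full_column_rank M"
    "\<And>x. x \<in> carrier_vec m \<Longrightarrow> qform m Y (($) x) = (M\<^sup>T *\<^sub>v x) \<bullet> (M\<^sup>T *\<^sub>v x)"
    using pos_def_factor[OF Y] by blast
  have MT: "M\<^sup>T \<in> carrier_mat m m" using M(1) by simp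
  define Q where "Q = U * M"
  define q where "q i = M\<^sup>T *\<^sub>v row U i" for i
  have Q: "Q \<in> carrier_mat n m" using U(1) M(1) by (simp add: Q_def)
  have q: "q i \<in> carrier_vec m" if "i < n" for i using that U(1) MT by (simp add: q_def)
  have row: "row U i \<in> carrier_vec m" if "i < n" for i using that U(1) by simp
  have "q i $ j = Q $$ (i, j)" if "i < n" "j < m" for i j
  proof -
    have "col M j \<bullet> row U i = row U i \<bullet> col M j"
      using that U(1) M(1) by (intro comm_scalar_prod[of _ m]) auto
    thus ?thesis using that U(1) M(1) by (simp add: q_def Q_def)
  qed
  moreover have "Q\<^sup>T *\<^sub>v ones_vec n = 0\<^sub>v m"
  proof -
    have "Q\<^sup>T *\<^sub>v ones_vec n = M\<^sup>T *\<^sub>v (U\<^sup>T *\<^sub>v ones_vec n)"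
      unfolding Q_def transpose_mult[OF U(1) M(1)] using U(1)
      by (intro assoc_mult_mat_vec[OF MT]) auto
    also have "\<dots> = 0\<^sub>v m" unfolding U(3) using M(1) by (intro eq_vecI) (auto simp: scalar_prod_def)
    finally show ?thesis .
  qed
  moreover have "full_column_rank Q" unfolding Q_def by (rule full_column_rank_mult[OF U(1) M(1) U(2) M(2)])
  ultimately have "affine_span n m q = carrier_vec m" by (intro affinely_spanning_rows[OF Q _ _ n]) auto
  hence "dim_framework n m G q" using fw q by (simp add: dim_framework_def bar_framework_def)
  moreover have "equivalent_configurations G p q"
    unfolding equivalent_configurations_def
  proof (intro ballI, clarify)
    fix a b assume ab: "(a, b) \<in> parcs G"
    hence "a < n" "b < n" using G.in_arcsD1 G.in_arcsD2 verts by auto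
    note rows = row[OF this(1)] row[OF this(2)]
    have diff: "row U a - row U b \<in> carrier_vec m" using rows by auto
    have "q a - q b = M\<^sup>T *\<^sub>v (row U a - row U b)"
      unfolding q_def by (rule mult_minus_distrib_mat_vec[symmetric, OF MT rows])
    hence "sq_dist (q a) (q b) = qform m Y (($) (row U a - row U b))" unfolding sq_dist_def M(3)[OF diff] by simp
    also have "\<dots> = qform m Y (\<lambda>k. U $$ (a, k) - U $$ (b, k))"
      unfolding qform_def using U(1) \<open>a < n\<close> \<open>b < n\<close> by (intro sum.cong refl) simp
    finally show "sq_dist (q a) (q b) = sq_dist (p a) (p b)" using eq[OF ab] by simp
  qed
  ultimately show False using rigid m unfolding dimensionally_rigid_def by (metis Suc_eq_plus1 Suc_leI)
qed


text \<open>The last conclusion secures progress: a basis of the kernel of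
  \<open>B\<^sup>T * W * B\<close> has fewer columns than \<open>B\<close>.\<close>

lemma rigid_imp_stress:
  assumes rigid: "dimensionally_rigid n r G p" and n: "0 < n" and d: "0 < d"
    and conf: "P = configuration_matrix n r p" and B: "B \<in> carrier_mat n d"
    and full: "full_column_rank (hcat P B)" and centered: "(hcat P B)\<^sup>T *\<^sub>v ones_vec n = 0\<^sub>v (r + d)"
  obtains W where "quasi_stress_matrix n r G p W" "psd ((hcat P B)\<^sup>T * W * hcat P B)"
    "P\<^sup>T * W * B = 0\<^sub>m r d" "B\<^sup>T * W * B \<noteq> 0\<^sub>m d d"
proof -
  define m where "m = r + d"
  define U where "U = hcat P B"
  define E where "E = parcs G"
  define D where "D = (\<lambda>(e :: nat \<times> nat) k. U $$ (fst e, k) - U $$ (snd e, k))"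
  define len where "len e = sq_dist (p (fst e)) (p (snd e))" for e :: "nat \<times> nat"
  have fw: "bar_framework n r G p" using rigid by (simp add: dimensionally_rigid_def dim_framework_def)
  interpret G: pair_graph G using fw by (simp add: bar_framework_def)
  have verts: "pverts G = {0..<n}" and p: "\<And>i. i < n \<Longrightarrow> p i \<in> carrier_vec r"
    using fw by (auto simp: bar_framework_def)
  have E: "E \<subseteq> {0..<n} \<times> {0..<n}" unfolding E_def using G.in_arcsD1 G.in_arcsD2 verts by auto
  have fin: "finite E" unfolding E_def by (rule G.pair_finite_arcs)
  have P: "P \<in> carrier_mat n r" by (simp add: conf)
  have U: "U \<in> carrier_mat n m" unfolding U_def m_def by (rule hcat_carrier[OF P B])
  have U_P: "U $$ (i, k) = P $$ (i, k)" if "i < n" "k < r" for i k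
    using that hcat_index[OF P B, of i k] by (simp add: U_def)
  have U_B: "U $$ (i, r + k) = B $$ (i, k)" if "i < n" "k < d" for i k
    using that hcat_index[OF P B, of i "r + k"] by (simp add: U_def)
  \<comment> \<open>The first \<open>r\<close> columns of \<open>U\<close> are those of
    \<open>P\<close>, so the prescribed lengths are the values of the form of diag(I, 0), a
    semidefinite but not definite matrix as \<open>d\<close> is positive.\<close>
  have len: "len e = (\<Sum>k<r. (D e k)\<^sup>2)" if "e \<in> E" for e
  proof -
    have "fst e < n" "snd e < n" using that E by auto
    thus ?thesis using p by (simp add: len_def D_def U_P conf configuration_matrix_index sq_dist_eq[of _ r])
  qed
  define C where "C = {(\<lambda>e. qform m Y (D e) - len e) | Y. pos_def m Y}"
  have C_ne: "C \<noteq> {}" using pos_def_rank_one_update[of 1 0] by (auto simp: C_def)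
  have conv: "(\<lambda>e. (1 - t) * x e + t * y e) \<in> C" if xy: "x \<in> C" "y \<in> C" and t: "0 < t" "t < 1" for x y t
  proof -
    obtain X Y where XY: "pos_def m X" "pos_def m Y"
      "x = (\<lambda>e. qform m X (D e) - len e)" "y = (\<lambda>e. qform m Y (D e) - len e)" using xy by (auto simp: C_def)
    have "(\<lambda>e. (1 - t) * x e + t * y e) = (\<lambda>e. qform m (\<lambda>i j. (1 - t) * X i j + t * Y i j) (D e) - len e)"
      unfolding XY(3,4) qform_convex_combination by (simp add: algebra_simps)
    thus ?thesis using pos_def_convex[OF XY(1,2) t] by (auto simp: C_def)
  qed
  have no_zero: "\<not> (\<exists>x\<in>C. \<forall>e\<in>E. x e = 0)"
  proof
    assume "\<exists>x\<in>C. \<forall>e\<in>E. x e = 0"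
    then obtain Y where Y: "pos_def m Y" "\<forall>e\<in>E. qform m Y (D e) - len e = 0" by (auto simp: C_def)
    have "\<exists>e\<in>parcs G. qform m Y (\<lambda>k. U $$ (fst e, k) - U $$ (snd e, k)) \<noteq> sq_dist (p (fst e)) (p (snd e))"
      using full centered d U Y(1) by (intro rigid_imp_no_pos_def_gram[OF rigid n]) (auto simp: U_def m_def)
    thus False using Y(2) by (auto simp: E_def D_def len_def)
  qed
  obtain w where w: "\<forall>x\<in>C. 0 \<le> (\<Sum>e\<in>E. w e * x e)" "\<exists>x\<in>C. 0 < (\<Sum>e\<in>E. w e * x e)"
    using proper_separation[OF fin C_ne conv no_zero] by blast
  \<comment> \<open>\<open>Z\<close> holds the entries of \<open>U\<^sup>T * W * U\<close> and
    represents the separating functional in the trace pairing with \<open>Y\<close>.\<close>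
  define Z where "Z k l = (\<Sum>e\<in>E. w e * (D e k * D e l))" for k l
  define W where "W = edge_stress n E w"
  have pairing: "(\<Sum>e\<in>E. w e * qform m Y (D e)) = (\<Sum>k<m. \<Sum>l<m. Z k l * Y k l)" for Y
  proof -
    have "(\<Sum>e\<in>E. w e * qform m Y (D e)) = (\<Sum>e\<in>E. \<Sum>k<m. \<Sum>l<m. w e * (D e k * D e l) * Y k l)"
      unfolding qform_def sum_distrib_left by (intro sum.cong refl) (simp only: mult_ac)
    also have "\<dots> = (\<Sum>k<m. \<Sum>e\<in>E. \<Sum>l<m. w e * (D e k * D e l) * Y k l)" by (rule sum.swap)
    also have "\<dots> = (\<Sum>k<m. \<Sum>l<m. \<Sum>e\<in>E. w e * (D e k * D e l) * Y k l)" by (intro sum.cong refl sum.swap)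
    finally show ?thesis by (simp add: Z_def sum_distrib_right)
  qed
  define \<delta> where "\<delta> = (\<Sum>e\<in>E. w e * len e)"
  \<comment> \<open>The constant term of the functional is the pairing of \<open>Z\<close> with
    diag(I, 0), hence the trace of the P-block.\<close>
  have \<delta>: "\<delta> = (\<Sum>k<r. Z k k)"
  proof -
    have "\<delta> = (\<Sum>e\<in>E. \<Sum>k<r. w e * (D e k * D e k))"
      unfolding \<delta>_def by (intro sum.cong refl) (simp add: len power2_eq_square sum_distrib_left)
    also have "\<dots> = (\<Sum>k<r. Z k k)" unfolding Z_def by (rule sum.swap)
    finally show ?thesis .
  qed
  have pairing_diff: "(\<Sum>e\<in>E. w e * (qform m Y (D e) - len e)) = (\<Sum>k<m. \<Sum>l<m. Z k l * Y k l) - \<delta>" for Y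
    unfolding pairing[symmetric] \<delta>_def by (simp add: right_diff_distrib sum_subtractf)
  have "\<delta> \<le> (\<Sum>k<m. \<Sum>l<m. Z k l * Y k l)" if "pos_def m Y" for Y
  proof -
    have "(\<lambda>e. qform m Y (D e) - len e) \<in> C" using that by (auto simp: C_def)
    from bspec[OF w(1) this] have "0 \<le> (\<Sum>e\<in>E. w e * (qform m Y (D e) - len e))" .
    thus ?thesis unfolding pairing_diff by simp
  qed
  note bounded = pairing_bounded_below[OF this]
  have Z_diag_nonneg: "0 \<le> Z k k" if "k < m" for k
  proof -
    have "qform m Z (\<lambda>i. if i = k then 1 else 0) = (\<Sum>i<m. \<Sum>j<m. if i = k then if j = k then Z k k else 0 else 0)"
      unfolding qform_def by (intro sum.cong refl) auto
    also have "\<dots> = (\<Sum>i<m. if i = k then \<Sum>j<m. if j = k then Z k k else 0 else 0)"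
      by (intro sum.cong refl) simp
    also have "\<dots> = Z k k" using that by simp
    finally show ?thesis using bounded(2)[of "\<lambda>i. if i = k then 1 else 0"] by simp
  qed
  \<comment> \<open>The trace \<open>\<delta>\<close> is at most 0 by the duality bound and is a sum
    of nonnegative entries, so each entry is 0.\<close>
  have Z_diag: "Z k k = 0" if "k < r" for k
  proof -
    have "(\<Sum>k<r. Z k k) = 0"
      using bounded(1) Z_diag_nonneg unfolding \<delta> m_def by (intro antisym sum_nonneg) auto
    thus ?thesis using Z_diag_nonneg that by (intro sum_nonneg_eq_0D[of "\<lambda>k. Z k k" r]) (auto simp: m_def)
  qed
  have \<delta>0: "\<delta> = 0" unfolding \<delta> using Z_diag by simp
  have UWU: "U\<^sup>T * W * U = mat m m (\<lambda>(k, l). Z k l)"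
  proof (rule eq_matI)
    fix i j assume "i < dim_row (mat m m (\<lambda>(k, l). Z k l))" "j < dim_col (mat m m (\<lambda>(k, l). Z k l))"
    hence ij: "i < m" "j < m" by auto
    show "(U\<^sup>T * W * U) $$ (i, j) = mat m m (\<lambda>(k, l). Z k l) $$ (i, j)"
      unfolding W_def edge_stress_congruence_index[OF E U U ij] using ij by (simp add: Z_def D_def)
  qed (use U in auto)
  have Zm: "U\<^sup>T * W * U \<in> carrier_mat m m" unfolding UWU by simp
  have psd: "psd (U\<^sup>T * W * U)"
  proof -
    have "0 \<le> x \<bullet> ((U\<^sup>T * W * U) *\<^sub>v x)" if x: "x \<in> carrier_vec m" for x
    proof -
      have "x \<bullet> ((U\<^sup>T * W * U) *\<^sub>v x) = qform m Z (($) x)"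
        unfolding scalar_prod_mult_mat_vec[OF Zm x x] qform_def unfolding UWU by (intro sum.cong refl) simp
      thus ?thesis using bounded(2) by simp
    qed
    moreover have "(U\<^sup>T * W * U)\<^sup>T = U\<^sup>T * W * U"
      unfolding UWU by (rule eq_matI) (auto simp: Z_def mult.commute)
    ultimately show ?thesis using Zm by (auto simp: psd_def)
  qed
  \<comment> \<open>A zero diagonal entry makes the unit vector isotropic for a semidefinite matrix,
    which clears its whole column and, by symmetry, its row.\<close>
  have Z_row: "Z k l = 0" if k: "k < r" and l: "l < m" for k l
  proof -
    have km: "k < m" using k by (simp add: m_def)
    have col: "(U\<^sup>T * W * U) *\<^sub>v unit_vec m k = vec m (\<lambda>l. Z l k)"
      unfolding UWU using km by (intro eq_vecI) auto
    have "unit_vec m k \<bullet> vec m (\<lambda>l. Z l k) = 0" using Z_diag[OF k] km by simp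
    hence "vec m (\<lambda>l. Z l k) = 0\<^sub>v m"
      using psd_isotropic_imp_kernel[OF Zm psd unit_vec_carrier, of k] unfolding col by blast
    hence "Z l k = 0" using l by (metis index_vec index_zero_vec(1))
    thus ?thesis by (simp add: Z_def mult.commute)
  qed
  have PWP: "P\<^sup>T * W * P = 0\<^sub>m r r"
  proof (rule eq_matI)
    fix i j assume "i < dim_row (0\<^sub>m r r :: real mat)" "j < dim_col (0\<^sub>m r r :: real mat)"
    hence ij: "i < r" "j < r" by auto
    have "(P\<^sup>T * W * P) $$ (i, j) = Z i j"
      unfolding W_def edge_stress_congruence_index[OF E P P ij] Z_def D_def
      using E ij by (intro sum.cong refl) (auto simp: U_P)
    thus "(P\<^sup>T * W * P) $$ (i, j) = 0\<^sub>m r r $$ (i, j)" using Z_row ij by (simp add: m_def)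
  qed (use P in auto)
  have PWB: "P\<^sup>T * W * B = 0\<^sub>m r d"
  proof (rule eq_matI)
    fix i j assume "i < dim_row (0\<^sub>m r d :: real mat)" "j < dim_col (0\<^sub>m r d :: real mat)"
    hence ij: "i < r" "j < d" by auto
    have "(P\<^sup>T * W * B) $$ (i, j) = Z i (r + j)"
      unfolding W_def edge_stress_congruence_index[OF E P B ij] Z_def D_def
      using E ij by (intro sum.cong refl) (auto simp: U_P U_B)
    thus "(P\<^sup>T * W * B) $$ (i, j) = 0\<^sub>m r d $$ (i, j)" using Z_row ij by (simp add: m_def)
  qed (use P B in auto)
  \<comment> \<open>The B-block is all that may remain of \<open>Z\<close>. Were it zero, the
    functional would vanish on all of \<open>C\<close>, against strict positivity at some
    point.\<close>
  have BWB: "B\<^sup>T * W * B \<noteq> 0\<^sub>m d d"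
  proof
    assume 0: "B\<^sup>T * W * B = 0\<^sub>m d d"
    have B_block: "Z (r + i) (r + j) = 0" if ij: "i < d" "j < d" for i j
    proof -
      have "(B\<^sup>T * W * B) $$ (i, j) = Z (r + i) (r + j)"
        unfolding W_def edge_stress_congruence_index[OF E B B ij] Z_def D_def
        using E ij by (intro sum.cong refl) (auto simp: U_B)
      thus ?thesis using 0 ij by simp
    qed
    have "Z k l = 0" if kl: "k < m" "l < m" for k l
    proof (cases "k < r \<or> l < r")
      case True
      have "Z k l = Z l k" by (simp add: Z_def mult.commute)
      thus ?thesis using True Z_row kl by auto
    next
      case False
      hence "k - r < d" "l - r < d" using kl by (auto simp: m_def)
      thus ?thesis using B_block[of "k - r" "l - r"] False by simp
    qed
    hence "(\<Sum>e\<in>E. w e * (qform m Y (D e) - len e)) = 0" for Y unfolding pairing_diff \<delta>0 by simp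
    thus False using w(2) by (auto simp: C_def)
  qed
  have "quasi_stress_matrix n r G p W"
    unfolding quasi_stress_matrix_def conf[symmetric]
  proof (intro conjI allI impI)
    fix i j assume ij: "i < n" "j < n" "i \<noteq> j \<and> (i, j) \<notin> parcs G"
    \<comment> \<open>Both orientations must be excluded, since an arc in either direction
      contributes to entry \<open>(i, j)\<close> of the Laplacian.\<close>
    hence "(j, i) \<notin> parcs G" using G.arcs_symmetric by blast
    hence "(i, j) \<notin> E" "(j, i) \<notin> E" using ij by (auto simp: E_def)
    hence "w e * (((if i = fst e then 1 else 0) - (if i = snd e then 1 else 0)) *
        ((if j = fst e then 1 else 0) - (if j = snd e then 1 else 0))) = 0" if "e \<in> E" for e
      using that ij(3) by (cases e) auto
    thus "W $$ (i, j) = 0" using ij by (simp add: W_def edge_stress_def)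
  qed (simp_all add: PWP, simp_all add: W_def edge_stress_ones[OF E] edge_stress_carrier edge_stress_symmetric)
  thus ?thesis by (rule that[OF _ psd[unfolded U_def] PWB BWB])
qed

section \<open>Facial reduction\<close>

text \<open>Strong induction on the number of columns of \<open>B\<close>: each stage removes as
  many columns as its rank, at least one. \<open>B\<close> may be any independent family orthogonal
  to T, which allows one use on the whole orthogonal complement and another on the kernel of an
  initial stress.\<close>

lemma stress_chain_exists:
  assumes rigid: "dimensionally_rigid n r G p" and n: "0 < n"
    and conf: "P = configuration_matrix n r p" and centered: "P\<^sup>T *\<^sub>v ones_vec n = 0\<^sub>v r"
    and "B \<in> carrier_mat n d" "full_column_rank B"
    and "\<And>c. c \<in> carrier_vec d \<Longrightarrow> (affine_matrix P)\<^sup>T *\<^sub>v (B *\<^sub>v c) = 0\<^sub>v (r + 1)"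
  shows "\<exists>(k :: nat) \<Omega> \<rho> \<xi>. k \<le> d \<and> (\<forall>i\<in>{1..k}. stress_stage n r G p (\<Omega> i) (\<rho> i) (\<xi> i)) \<and>
    (1 \<le> k \<longrightarrow> \<rho> 1 = B) \<and> (\<forall>i\<in>{1..<k}. \<rho> (i + 1) = \<rho> i * \<xi> i) \<and>
    (\<Sum>i\<in>{1..k}. mat_rank ((hcat P (\<rho> i))\<^sup>T * \<Omega> i * hcat P (\<rho> i))) = d"
  using assms(5-7)
proof (induction d arbitrary: B rule: less_induct)
  case (less d)
  note B = less.prems(1) and fB = less.prems(2) and orth = less.prems(3)
  have fw: "dim_framework n r G p" using rigid by (simp add: dimensionally_rigid_def)
  have P: "P \<in> carrier_mat n r" by (simp add: conf)
  have fP: "full_column_rank P" unfolding conf by (rule configuration_matrix_full_column_rank[OF fw])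
  show ?case
  proof (cases "d = 0")
    case True
    thus ?thesis by (intro exI[of _ 0]) auto
  next
    case False
    have Bc: "B *\<^sub>v c \<in> carrier_vec n" if "c \<in> carrier_vec d" for c using B that by auto
    have orth': "P\<^sup>T *\<^sub>v (B *\<^sub>v c) = 0\<^sub>v r" "ones_vec n \<bullet> (B *\<^sub>v c) = 0" if "c \<in> carrier_vec d" for c
      using orth[OF that] affine_matrix_transpose_eq_0_iff[OF P Bc[OF that]] by auto
    have fU: "full_column_rank (hcat P B)" by (rule hcat_full_column_rank[OF P B fP fB orth'(1)])
    have "B\<^sup>T *\<^sub>v ones_vec n = 0\<^sub>v d"
    proof (rule scalar_prod_self_eq_0)
      show c: "B\<^sup>T *\<^sub>v ones_vec n \<in> carrier_vec d" using B by auto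
      show "(B\<^sup>T *\<^sub>v ones_vec n) \<bullet> (B\<^sup>T *\<^sub>v ones_vec n) = 0"
        using transpose_scalar_prod(1)[OF B _ c, of "ones_vec n"] orth'(2)[OF c] by simp
    qed
    moreover have "0\<^sub>v (r + d) = 0\<^sub>v r @\<^sub>v (0\<^sub>v d :: real vec)" by (intro eq_vecI) auto
    ultimately have "(hcat P B)\<^sup>T *\<^sub>v ones_vec n = 0\<^sub>v (r + d)"
      unfolding hcat_transpose_mult_vec[OF P B vec_carrier] centered by simp
    then obtain W where W: "quasi_stress_matrix n r G p W" "psd ((hcat P B)\<^sup>T * W * hcat P B)"
      "P\<^sup>T * W * B = 0\<^sub>m r d" "B\<^sup>T * W * B \<noteq> 0\<^sub>m d d"
      using rigid_imp_stress[OF rigid n _ conf B fU] False by blast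
    interpret stress: configuration_stress n r P W unfolding conf by (rule quasi_stress_imp_configuration_stress[OF W(1)])
    have BWB: "B\<^sup>T * W * B \<in> carrier_mat d d" using stress.congruence_symmetric(1)[OF B] .
    obtain d' X where X: "X \<in> carrier_mat d d'" "full_column_rank X" "column_space X = mat_kernel (B\<^sup>T * W * B)"
      using kernel_basis_matrix[OF BWB] by blast
    have rank: "mat_rank ((hcat P B)\<^sup>T * W * hcat P B) + d' = d" by (rule stress.rank_block[OF B W(3) X])
    \<comment> \<open>With \<open>d' = d\<close> the matrix \<open>X\<close> would be square and
      injective, hence onto, and the kernel of \<open>B\<^sup>T * W * B\<close> would be
      everything.\<close>
    have "d' \<noteq> d"
    proof
      assume eq: "d' = d"
      have "(B\<^sup>T * W * B) *\<^sub>v y = 0\<^sub>m d d *\<^sub>v y" if y: "y \<in> carrier_vec d" for y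
      proof -
        obtain x where x: "x \<in> carrier_vec d" "X *\<^sub>v x = y"
          using square_injective_surjective[OF X(1)[unfolded eq] _ y] full_column_rankD[OF X(2) X(1)[unfolded eq]] by blast
        have "y \<in> column_space X" unfolding column_space_eq[OF X(1)] eq using x by auto
        hence "(B\<^sup>T * W * B) *\<^sub>v y = 0\<^sub>v d" unfolding X(3) using mat_kernelD[OF BWB] by auto
        thus ?thesis using y by auto
      qed
      hence "B\<^sup>T * W * B = 0\<^sub>m d d" by (intro eq_mat_vecI[OF BWB]) auto
      thus False using W(4) by simp
    qed
    hence d': "d' < d" using rank by simp
    have W_ne: "W \<noteq> 0\<^sub>m n n" using W(4) B by auto
    have BX: "B * X \<in> carrier_mat n d'" using B X(1) by auto
    have fBX: "full_column_rank (B * X)" by (rule full_column_rank_mult[OF B X(1) fB X(2)])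
    have orthBX: "(affine_matrix P)\<^sup>T *\<^sub>v (B * X *\<^sub>v c) = 0\<^sub>v (r + 1)" if c: "c \<in> carrier_vec d'" for c
      unfolding assoc_mult_mat_vec[OF B X(1) c] using X(1) c by (intro orth) auto
    obtain k \<Omega> \<rho> \<xi> where IH: "k \<le> d'" "\<And>i. i \<in> {1..k} \<Longrightarrow> stress_stage n r G p (\<Omega> i) (\<rho> i) (\<xi> i)"
      "1 \<le> k \<Longrightarrow> \<rho> 1 = B * X" "\<And>i. i \<in> {1..<k} \<Longrightarrow> \<rho> (i + 1) = \<rho> i * \<xi> i"
      "(\<Sum>i\<in>{1..k}. mat_rank ((hcat P (\<rho> i))\<^sup>T * \<Omega> i * hcat P (\<rho> i))) = d'"
      using less.IH[OF d' BX fBX orthBX] by blast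
    \<comment> \<open>The new stage goes in front of the chain from the induction hypothesis, whose
      stages are numbered from 1 and move up by one.\<close>
    define shift :: "real mat \<Rightarrow> (nat \<Rightarrow> real mat) \<Rightarrow> nat \<Rightarrow> real mat"
      where "shift A f i = (if i = 1 then A else f (i - 1))" for A f i
    have shift1: "shift A f 1 = A" for A f by (simp add: shift_def)
    have shift_Suc: "shift A f (Suc i) = f i" if "1 \<le> i" for A f i using that by (simp add: shift_def)
    have stage1: "stress_stage n r G p W B X"
      using W W_ne fB fU X B unfolding stress_stage_def Let_def conf by simp
    have stages: "stress_stage n r G p (shift W \<Omega> i) (shift B \<rho> i) (shift X \<xi> i)" if "i \<in> {1..Suc k}" for i
    proof (cases "i = 1")
      case True
      thus ?thesis using stage1 by (simp only: shift1)
    next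
      case False
      hence "shift A f i = f (i - 1)" for A f by (simp add: shift_def)
      moreover have "i - 1 \<in> {1..k}" using False that by auto
      ultimately show ?thesis using IH(2) by simp
    qed
    have succ: "shift B \<rho> (i + 1) = shift B \<rho> i * shift X \<xi> i" if i: "i \<in> {1..<Suc k}" for i
    proof (cases "i = 1")
      case True
      hence "1 \<le> k" using i by simp
      thus ?thesis using IH(3) unfolding True by (simp add: shift_def)
    next
      case False
      moreover obtain j where "i = Suc j" using i by (cases i) auto
      ultimately show ?thesis using IH(4)[of j] i by (simp add: shift_def)
    qed
    let ?rk = "\<lambda>\<Omega> \<rho> i. mat_rank ((hcat P (\<rho> i))\<^sup>T * \<Omega> i * hcat P (\<rho> i))"
    have "(\<Sum>i\<in>{1..Suc k}. ?rk (shift W \<Omega>) (shift B \<rho>) i)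
      = ?rk (shift W \<Omega>) (shift B \<rho>) 1 + (\<Sum>i\<in>{Suc 1..Suc k}. ?rk (shift W \<Omega>) (shift B \<rho>) i)"
      by (rule sum.atLeast_Suc_atMost) simp
    also have "(\<Sum>i\<in>{Suc 1..Suc k}. ?rk (shift W \<Omega>) (shift B \<rho>) i) = (\<Sum>i\<in>{1..k}. ?rk \<Omega> \<rho> i)"
      unfolding sum.shift_bounds_cl_Suc_ivl by (intro sum.cong refl) (simp add: shift_Suc)
    also have "?rk (shift W \<Omega>) (shift B \<rho>) 1 + \<dots> = d" unfolding shift1 IH(5) by (rule rank)
    finally have sum: "(\<Sum>i\<in>{1..Suc k}. ?rk (shift W \<Omega>) (shift B \<rho>) i) = d" .
    show ?thesis
      by (rule exI[of _ "Suc k"], rule exI[of _ "shift W \<Omega>"], rule exI[of _ "shift B \<rho>"],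
        rule exI[of _ "shift X \<xi>"]) (use IH(1) d' stages succ sum in \<open>simp add: shift_def\<close>)
  qed
qed

text \<open>Every vector is T a + B c when the columns of \<open>B\<close> span the orthogonal
  complement of T. A stress that is semidefinite on the columns of \<open>P\<close> and
  \<open>B\<close> and has vanishing mixed block is therefore semidefinite on the whole
  space.\<close>

lemma rigid_imp_psd_stress:
  assumes rigid: "dimensionally_rigid n r G p" and n: "r + 2 \<le> n"
    and conf: "P = configuration_matrix n r p" and centered: "P\<^sup>T *\<^sub>v ones_vec n = 0\<^sub>v r"
  obtains W where "quasi_stress_matrix n r G p W" "psd W" "W \<noteq> 0\<^sub>m n n"
proof -
  have fw: "dim_framework n r G p" using rigid by (simp add: dimensionally_rigid_def)
  have P: "P \<in> carrier_mat n r" by (simp add: conf)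
  have fP: "full_column_rank P" unfolding conf by (rule configuration_matrix_full_column_rank[OF fw])
  have n_pos: "0 < n" using n by simp
  let ?T = "affine_matrix P"
  have T: "?T \<in> carrier_mat n (r + 1)" by (rule affine_matrix_carrier[OF P])
  have fT: "full_column_rank ?T" using affine_matrix_full_column_rank[OF P fP centered] n by simp
  have TT: "?T\<^sup>T \<in> carrier_mat (r + 1) n" using T by simp
  obtain d B where B: "B \<in> carrier_mat n d" "full_column_rank B" "column_space B = mat_kernel (?T\<^sup>T)"
    using kernel_basis_matrix[OF TT] by blast
  have orth: "?T\<^sup>T *\<^sub>v (B *\<^sub>v c) = 0\<^sub>v (r + 1)" if "c \<in> carrier_vec d" for c
  proof -
    have "B *\<^sub>v c \<in> mat_kernel (?T\<^sup>T)" using B(3) that unfolding column_space_eq[OF B(1)] by auto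
    thus ?thesis using mat_kernelD[OF TT] by auto
  qed
  \<comment> \<open>Orthogonality to T amounts to \<open>r + 1\<close> linear equations in
    \<open>n\<close> unknowns, and \<open>r + 2 \<le> n\<close> leaves a nonzero solution.\<close>
  have "0 < d"
  proof (rule ccontr)
    assume "\<not> 0 < d"
    hence d: "d = 0" by simp
    obtain z where z: "z \<in> carrier_vec n" "z \<noteq> 0\<^sub>v n" "\<And>l. l < r + 1 \<Longrightarrow> (\<Sum>j<n. ?T $$ (j, l) * z $ j) = 0"
      using wide_matrix_kernel[of "r + 1" n "\<lambda>l j. ?T $$ (j, l)"] n by auto
    have "?T\<^sup>T *\<^sub>v z = 0\<^sub>v (r + 1)"
      using z(1,3) T by (intro eq_vecI) (auto simp: scalar_prod_def lessThan_atLeast0)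
    hence "z \<in> column_space B" unfolding B(3) using z(1) by (intro mat_kernelI[OF TT]) auto
    then obtain c where "c \<in> carrier_vec 0" "z = B *\<^sub>v c" unfolding column_space_eq[OF B(1)] d by auto
    hence "z = 0\<^sub>v n" using B(1) by (intro eq_vecI) (auto simp: scalar_prod_def)
    thus False using z(2) by simp
  qed
  \<comment> \<open>Only the first stage of this chain is kept; since \<open>d\<close> is positive
    and equals the sum of the ranks, there is one.\<close>
  obtain k \<Omega> \<rho> \<xi> where chain: "\<And>i. i \<in> {1..k} \<Longrightarrow> stress_stage n r G p (\<Omega> i) (\<rho> i) (\<xi> i)"
    "1 \<le> k \<Longrightarrow> \<rho> (1::nat) = B" "(\<Sum>i\<in>{1..k}. mat_rank ((hcat P (\<rho> i))\<^sup>T * \<Omega> i * hcat P (\<rho> i))) = d"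
    using stress_chain_exists[OF rigid n_pos conf centered B(1,2) orth] by blast
  have k: "1 \<le> k"
  proof (rule ccontr)
    assume "\<not> 1 \<le> k"
    hence empty: "{1..k} = {}" by simp
    have "d = 0" using chain(3)[symmetric] unfolding empty sum.empty .
    thus False using \<open>0 < d\<close> by simp
  qed
  have W: "quasi_stress_matrix n r G p (\<Omega> 1)" "\<Omega> 1 \<noteq> 0\<^sub>m n n"
    "psd ((hcat P B)\<^sup>T * \<Omega> 1 * hcat P B)" "P\<^sup>T * \<Omega> 1 * B = 0\<^sub>m r d"
    using chain(1)[of 1] chain(2)[OF k] k B(1) by (auto simp: stress_stage_def Let_def conf)
  interpret stress: configuration_stress n r P "\<Omega> 1" unfolding conf by (rule quasi_stress_imp_configuration_stress[OF W(1)])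
  note BWB = stress.congruence_symmetric(1)[OF B(1)]
  note psd_B = stress.psd_block[OF B(1) W(3,4)]
  have "0 \<le> x \<bullet> (\<Omega> 1 *\<^sub>v x)" if x: "x \<in> carrier_vec n" for x
  proof -
    obtain a y where ay: "a \<in> carrier_vec (r + 1)" "y \<in> carrier_vec n" "x = ?T *\<^sub>v a + y" "?T\<^sup>T *\<^sub>v y = 0\<^sub>v (r + 1)"
      using orthogonal_decomposition[OF T fT x] .
    hence "y \<in> column_space B" unfolding B(3) by (intro mat_kernelI[OF TT]) auto
    then obtain c where c: "c \<in> carrier_vec d" "y = B *\<^sub>v c" unfolding column_space_eq[OF B(1)] by auto
    show ?thesis
      unfolding ay(3) c(2) stress.quadratic_form_decompose[OF B(1) W(4) ay(1) c(1)] by (rule psdD(2)[OF psd_B BWB c(1)])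
  qed
  hence "psd (\<Omega> 1)" using stress.W stress.W_sym by (auto simp: psd_def)
  thus thesis using that W by blast
qed

theorem theorem3p4:
  fixes n r :: nat
    and G :: "nat pair_pre_digraph"
    and p :: "nat \<Rightarrow> real vec"
    and P :: "real mat"
  assumes "dim_framework n r G p"
    and "r + 2 \<le> n"
    and "P = configuration_matrix n r p"
    and "P\<^sup>T *\<^sub>v ones_vec n = 0\<^sub>v r"
  shows "dimensionally_rigid n r G p \<longleftrightarrow>
    (\<exists>(k :: nat) (\<Omega> :: nat \<Rightarrow> real mat) (\<rho> :: nat \<Rightarrow> real mat)
        (\<xi> :: nat \<Rightarrow> real mat) (U :: nat \<Rightarrow> real mat).
       k \<le> n - r - 1 \<and>
       (\<forall>i\<le>k. quasi_stress_matrix n r G p (\<Omega> i) \<and> \<Omega> i \<noteq> 0\<^sub>m n n) \<and>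
       (\<forall>i\<in>{1..k}. full_column_rank (\<rho> i) \<and> full_column_rank (U i) \<and> full_column_rank (\<xi> i)) \<and>
       (1 \<le> k \<longrightarrow> column_space (\<rho> 1) = mat_kernel (\<Omega> 0 @\<^sub>r P\<^sup>T @\<^sub>r mat_of_row (ones_vec n))) \<and>
       (\<forall>i\<in>{1..k}. column_space (\<xi> i) = mat_kernel ((\<rho> i)\<^sup>T * \<Omega> i * \<rho> i)) \<and>
       (\<forall>i\<in>{1..k}. U i = hcat P (\<rho> i)) \<and>
       (\<forall>i\<in>{1..<k}. \<rho> (i + 1) = \<rho> i * \<xi> i) \<and>
       psd (\<Omega> 0) \<and>
       (\<forall>i\<in>{1..k}. psd ((U i)\<^sup>T * \<Omega> i * U i)) \<and>
       mat_rank (\<Omega> 0) + (\<Sum>i\<in>{1..k}. mat_rank ((U i)\<^sup>T * \<Omega> i * U i)) = n - r - 1 \<and>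
       (\<forall>i\<in>{1..k}. P\<^sup>T * \<Omega> i * \<rho> i = 0\<^sub>m r (dim_col (\<rho> i))))"
proof (rule iffI, goal_cases)
  case rigid: 1
  note centered = assms(4) and conf = assms(3)
  have n_pos: "0 < n" using assms(2) by simp
  have P: "P \<in> carrier_mat n r" by (simp add: conf)
  have fP: "full_column_rank P" unfolding conf by (rule configuration_matrix_full_column_rank[OF assms(1)])
  have fT: "full_column_rank (affine_matrix P)" using affine_matrix_full_column_rank[OF P fP centered] assms(2) by simp
  \<comment> \<open>The initial stress is fixed first, because the chain has to start from the part
    of its kernel orthogonal to T.\<close>
  obtain W where W: "quasi_stress_matrix n r G p W" "psd W" "W \<noteq> 0\<^sub>m n n"
    using rigid_imp_psd_stress[OF rigid assms(2) conf centered] .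
  interpret stress: configuration_stress n r P W unfolding conf by (rule quasi_stress_imp_configuration_stress[OF W(1)])
  have "W @\<^sub>r P\<^sup>T @\<^sub>r mat_of_row (ones_vec n) \<in> carrier_mat (n + (r + 1)) n"
    by (intro carrier_append_rows) (use stress.W P in auto)
  then obtain d B where B: "B \<in> carrier_mat n d" "full_column_rank B"
    "column_space B = mat_kernel (W @\<^sub>r P\<^sup>T @\<^sub>r mat_of_row (ones_vec n))"
    by (rule kernel_basis_matrix)
  have rank: "mat_rank W + (r + 1) + d = n" by (rule stress.psd_rank[OF W(2) fT B])
  have orth: "(affine_matrix P)\<^sup>T *\<^sub>v (B *\<^sub>v c) = 0\<^sub>v (r + 1)" if "c \<in> carrier_vec d" for c
  proof -
    have "B *\<^sub>v c \<in> column_space B" unfolding column_space_eq[OF B(1)] using that by auto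
    thus ?thesis unfolding B(3) stacked_kernel_eq[OF stress.W P] by simp
  qed
  obtain k \<Omega> \<rho> \<xi> where chain: "k \<le> d" "\<And>i. i \<in> {1..k} \<Longrightarrow> stress_stage n r G p (\<Omega> i) (\<rho> i) (\<xi> i)"
    "1 \<le> k \<Longrightarrow> \<rho> (1::nat) = B" "\<And>i. i \<in> {1..<k} \<Longrightarrow> \<rho> (i + 1) = \<rho> i * \<xi> i"
    "(\<Sum>i\<in>{1..k}. mat_rank ((hcat P (\<rho> i))\<^sup>T * \<Omega> i * hcat P (\<rho> i))) = d"
    using stress_chain_exists[OF rigid n_pos conf centered B(1,2) orth] by blast
  \<comment> \<open>The chain is numbered from 1, so index 0 is free for the initial stress.\<close>
  define \<Omega>' where "\<Omega>' i = (if i = 0 then W else \<Omega> i)" for i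
  have \<Omega>': "\<Omega>' 0 = W" "\<And>i. i \<in> {1..k} \<Longrightarrow> \<Omega>' i = \<Omega> i" by (auto simp: \<Omega>'_def)
  have sum: "(\<Sum>i\<in>{1..k}. mat_rank ((hcat P (\<rho> i))\<^sup>T * \<Omega>' i * hcat P (\<rho> i))) = d"
    unfolding chain(5)[symmetric] by (intro sum.cong refl) (simp only: \<Omega>')
  have stage: "quasi_stress_matrix n r G p (\<Omega>' i)" "\<Omega>' i \<noteq> 0\<^sub>m n n"
    "full_column_rank (\<rho> i)" "full_column_rank (hcat P (\<rho> i))" "full_column_rank (\<xi> i)"
    "column_space (\<xi> i) = mat_kernel ((\<rho> i)\<^sup>T * \<Omega>' i * \<rho> i)" "psd ((hcat P (\<rho> i))\<^sup>T * \<Omega>' i * hcat P (\<rho> i))"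
    "P\<^sup>T * \<Omega>' i * \<rho> i = 0\<^sub>m r (dim_col (\<rho> i))" if "i \<in> {1..k}" for i
    using chain(2)[OF that] unfolding \<Omega>'(2)[OF that] stress_stage_def Let_def conf by auto
  have nonzero: "quasi_stress_matrix n r G p (\<Omega>' i) \<and> \<Omega>' i \<noteq> 0\<^sub>m n n" if "i \<le> k" for i
  proof (cases "i = 0")
    case True
    thus ?thesis using W(1,3) \<Omega>'(1) by simp
  next
    case False
    hence "i \<in> {1..k}" using that by simp
    thus ?thesis using stage(1,2) by blast
  qed
  let ?U = "\<lambda>i. hcat P (\<rho> i)"
  show ?case
  proof (rule exI[of _ k], rule exI[of _ \<Omega>'], rule exI[of _ \<rho>], rule exI[of _ \<xi>], rule exI[of _ ?U], intro conjI)
    \<comment> \<open>The chain has at most \<open>d\<close> stages, and \<open>d\<close> is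
      \<open>n - r - 1\<close> minus the rank of the initial stress.\<close>
    show "k \<le> n - r - 1" using chain(1) rank by linarith
    show "\<forall>i\<le>k. quasi_stress_matrix n r G p (\<Omega>' i) \<and> \<Omega>' i \<noteq> 0\<^sub>m n n" using nonzero by blast
    show "\<forall>i\<in>{1..k}. full_column_rank (\<rho> i) \<and> full_column_rank (?U i) \<and> full_column_rank (\<xi> i)"
      using stage(3-5) by blast
    show "1 \<le> k \<longrightarrow> column_space (\<rho> 1) = mat_kernel (\<Omega>' 0 @\<^sub>r P\<^sup>T @\<^sub>r mat_of_row (ones_vec n))"
      unfolding \<Omega>'(1) B(3)[symmetric] by (intro impI arg_cong[of _ _ column_space] chain(3))
    show "\<forall>i\<in>{1..k}. column_space (\<xi> i) = mat_kernel ((\<rho> i)\<^sup>T * \<Omega>' i * \<rho> i)" using stage(6) by blast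
    show "\<forall>i\<in>{1..k}. ?U i = hcat P (\<rho> i)" by blast
    show "\<forall>i\<in>{1..<k}. \<rho> (i + 1) = \<rho> i * \<xi> i" using chain(4) by blast
    show "psd (\<Omega>' 0)" unfolding \<Omega>'(1) by (rule W(2))
    show "\<forall>i\<in>{1..k}. psd ((?U i)\<^sup>T * \<Omega>' i * ?U i)" using stage(7) by blast
    show "mat_rank (\<Omega>' 0) + (\<Sum>i\<in>{1..k}. mat_rank ((?U i)\<^sup>T * \<Omega>' i * ?U i)) = n - r - 1"
      unfolding \<Omega>'(1) sum using rank by linarith
    show "\<forall>i\<in>{1..k}. P\<^sup>T * \<Omega>' i * \<rho> i = 0\<^sub>m r (dim_col (\<rho> i))" using stage(8) by blast
  qed
next
  case 2
  then obtain k :: nat and \<Omega> \<rho> \<xi> U where h: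
    "\<forall>i\<le>k. quasi_stress_matrix n r G p (\<Omega> i) \<and> \<Omega> i \<noteq> 0\<^sub>m n n"
    "\<forall>i\<in>{1..k}. full_column_rank (\<rho> i) \<and> full_column_rank (U i) \<and> full_column_rank (\<xi> i)"
    "1 \<le> k \<longrightarrow> column_space (\<rho> 1) = mat_kernel (\<Omega> 0 @\<^sub>r P\<^sup>T @\<^sub>r mat_of_row (ones_vec n))"
    "\<forall>i\<in>{1..k}. column_space (\<xi> i) = mat_kernel ((\<rho> i)\<^sup>T * \<Omega> i * \<rho> i)"
    "\<forall>i\<in>{1..k}. U i = hcat P (\<rho> i)"
    "\<forall>i\<in>{1..<k}. \<rho> (i + 1) = \<rho> i * \<xi> i"
    "psd (\<Omega> 0)"
    "\<forall>i\<in>{1..k}. psd ((U i)\<^sup>T * \<Omega> i * U i)"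
    "mat_rank (\<Omega> 0) + (\<Sum>i\<in>{1..k}. mat_rank ((U i)\<^sup>T * \<Omega> i * U i)) = n - r - 1"
    "\<forall>i\<in>{1..k}. P\<^sup>T * \<Omega> i * \<rho> i = 0\<^sub>m r (dim_col (\<rho> i))"
    by blast
  have stage: "stress_stage n r G p (\<Omega> i) (\<rho> i) (\<xi> i)" if "i \<in> {1..k}" for i
    using h(1,2,4,5,8,10) that unfolding stress_stage_def Let_def assms(3) by auto
  have "(\<Sum>i\<in>{1..k}. mat_rank ((U i)\<^sup>T * \<Omega> i * U i))
    = (\<Sum>i\<in>{1..k}. mat_rank ((hcat P (\<rho> i))\<^sup>T * \<Omega> i * hcat P (\<rho> i)))"
    by (intro sum.cong refl) (use h(5) in simp)
  with h(9) have rank: "mat_rank (\<Omega> 0) + (\<Sum>i\<in>{1..k}. mat_rank ((hcat P (\<rho> i))\<^sup>T * \<Omega> i * hcat P (\<rho> i))) = n - r - 1"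
    by simp
  show ?case
  proof (rule stress_chain_imp_dimensionally_rigid[OF assms _ h(7) stage _ _ rank])
    show "quasi_stress_matrix n r G p (\<Omega> 0)" using h(1) by simp
    show "column_space (\<rho> 1) = mat_kernel (\<Omega> 0 @\<^sub>r P\<^sup>T @\<^sub>r mat_of_row (ones_vec n))" if "1 \<le> k"
      using h(3) that by blast
    show "\<rho> (i + 1) = \<rho> i * \<xi> i" if "i \<in> {1..<k}" for i using h(6) that by blast
  qed
qed

end
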